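(* Let $p(z)=a_0z^n+a_1z^{n-1}+\dots+a_n$ be a real polynomial of degree $n\geqslant 1$ with $a_0>0$ and $a_n\neq0$, and suppose that its finite Hurwitz matrix $\mathcal{H}_n(p)$ is totally nonnegative. Let $m$, $0\leqslant m\leqslant n$, be the number such that $\Delta_m(p)\neq0$ and $\Delta_{m+1}(p)=0$. Then, counting algebraic multiplicities, $\mathcal{H}_n(p)$ has $\frac{n+m}{2}$ positive eigenvalues and $\frac{n-m}{2}$ zero eigenvalues. The eigenspaces of the positive eigenvalues are one-dimensional, and the dimension of the eigenspace of the zero eigenvalue is $\frac{n-m}{2}$. All positive eigenvalues of $\mathcal{H}_n(p)$ are simple, with the possible exception of exactly one, which is equal to $p(0)$ and has (algebraic) multiplicity $2$.
   Context: For a real polynomial $p(z)=a_0z^n+a_1z^{n-1}+\dots+a_n$, put $a_k=0$ for $k<0$ and $k>n$. The finite Hurwitz matrix of $p$ is the $n\times n$ matrix $\mathcal{H}_n(p)=(a_{2j-i})_{i,j=1}^n$. For $1\leqslant j\leqslant n$, $\Delta_j(p)$ denotes the leading principal minor of $\mathcal{H}_n(p)$ of order $j$; by convention $\Delta_0(p)=1$ and $\Delta_{n+1}(p)=0$. A matrix is totally nonnegative if all its minors are nonnegative. The statement that the zero eigenvalue has an eigenspace of dimension $0$ (when $m=n$) means that $0$ is not an eigenvalue. *)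

theory Defs
  imports
    "Jordan_Normal_Form.Char_Poly"
    "Jordan_Normal_Form.Matrix_Kernel"
    "Jordan_Normal_Form.DL_Submatrix"
begin

text \<open>Coefficients are numbered from the leading one: \<open>p(z) = a\<^sub>0 z^n + \<dots> + a\<^sub>n\<close> with
  \<open>n = degree p\<close>, and \<open>a\<^sub>k = 0\<close> for every integer \<open>k\<close> outside \<open>0, \<dots>, n\<close>.\<close>

definition desc_coeff :: "'a::zero poly \<Rightarrow> int \<Rightarrow> 'a" where
  "desc_coeff p k =
     (if 0 \<le> k \<and> k \<le> int (degree p) then Polynomial.coeff p (degree p - nat k) else 0)"

text \<open>Matrix indices start at \<open>0\<close>, so the entry \<open>a\<^sub>2\<^sub>j\<^sub>-\<^sub>i\<close> of the usual
  \<open>1\<close>-based convention is shifted by one in both indices.\<close>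

definition hurwitz_matrix :: "'a::zero poly \<Rightarrow> 'a mat" where
  "hurwitz_matrix p = mat (degree p) (degree p)
     (\<lambda>(i, j). desc_coeff p (2 * int (j + 1) - int (i + 1)))"

text \<open>The value at \<open>degree p + 1\<close> (and beyond) is \<open>0\<close> by convention; the case \<open>j = 0\<close> is the empty
  determinant \<open>1\<close>.\<close>

definition hurwitz_minor :: "'a::comm_ring_1 poly \<Rightarrow> nat \<Rightarrow> 'a" where
  "hurwitz_minor p j =
     (if j \<le> degree p then det (submatrix (hurwitz_matrix p) {..<j} {..<j}) else 0)"

definition totally_nonneg :: "'a::linordered_idom mat \<Rightarrow> bool" where
  "totally_nonneg A \<longleftrightarrow>
     (\<forall>I J. I \<subseteq> {..<dim_row A} \<longrightarrow> J \<subseteq> {..<dim_col A} \<longrightarrow> card I = card J \<longrightarrow>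
        0 \<le> det (submatrix A I J))"

text \<open>\<open>Polynomial.order\<close> is the multiplicity of a root; the qualifier is needed because
  \<open>order\<close> also names the order of a group.\<close>

definition alg_mult :: "'a::idom mat \<Rightarrow> 'a \<Rightarrow> nat" where
  "alg_mult A x = Polynomial.order x (char_poly A)"

text \<open>The eigenspace of \<open>x\<close> is the kernel of \<open>char_matrix A x\<close>, that is of \<open>A - x I\<close>.\<close>

definition eigenspace_dim :: "'a::field mat \<Rightarrow> 'a \<Rightarrow> nat" where
  "eigenspace_dim A x = kernel_dim (char_matrix A x)"

end

theory Submission
  imports Defs
    "Jordan_Normal_Form.Jordan_Normal_Form_Existence"
    "Jordan_Normal_Form.Jordan_Normal_Form_Uniqueness"
begin

text \<open>
  Write \<open>p = \<Sum>a\<^sub>k z^(n-k)\<close>. If \<open>a\<^sub>1 = 0\<close>, total nonnegativity makes \<open>p\<close> even and every second row of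
  \<open>H\<close> zero; deleting these rows and the corresponding columns leaves the Hurwitz matrix of \<open>g\<close>, where
  \<open>p(z) = g(z\<^sup>2)\<close>. Otherwise all \<open>a\<^sub>k\<close> are positive, and \<open>H\<close> has positive sub- and superdiagonal, except
  that its last column is \<open>a\<^sub>n\<close> times the last unit vector. Neville elimination preserves total
  nonnegativity (Whitney), and so does the column operation completing it to a similarity. Applied to
  the rows, with removal of the rows that become zero, it brings \<open>H\<close> to upper Hessenberg form with positive
  subdiagonal, so eigenspaces of nonzero eigenvalues are lines; after splitting off \<open>a\<^sub>n = p(0)\<close>,
  the same process on the transpose yields a totally nonnegative tridiagonal matrix, whose eigenvalues
  are nonnegative and simple.

  For the eigenvalue \<open>0\<close> and \<open>m < n\<close>, total nonnegativity and the vanishing of \<open>\<Delta>\<^sub>m\<^sub>+\<^sub>1\<close> force row \<open>m + 1\<close> to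
  depend on the first \<open>m\<close> rows. By the shift structure of \<open>H\<close> the same relation holds for the rows
  \<open>m + 3, m + 5, \<dots>\<close>, which makes \<open>n - m\<close> even and the kernel at least \<open>(n - m) / 2\<close>-dimensional. The principal minor on the
  remaining \<open>(n + m) / 2\<close> indices is nonzero. Since all principal minors are nonnegative, the
  coefficient of \<open>x^((n - m) / 2)\<close> in the characteristic polynomial does not vanish.
\<close>

section \<open>Minors\<close>

text \<open>The possible double eigenvalue comes from the corner entry: \<open>H\<close> is block
  triangular with diagonal blocks \<open>a_n\<close> and the rest, and \<open>a_n\<close> may again
  be an eigenvalue of the rest. One-dimensionality of eigenspaces must therefore be read off the
  Hessenberg form of the entire matrix, while simplicity can hold only for the complementary block.
  Hence two reductions, of which the second is followed through the characteristic polynomial alone.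

  The obstacle is singularity: Neville elimination needs nonzero pivots. Positivity next to the
  diagonal is the invariant that supplies them through 2 x 2 minors; it can break down only if a
  full row vanishes, and deleting that row with its column costs one factor x.

  For the eigenvalue 0 both multiplicities are squeezed: (n-m)/2 \<le> geometric \<le> algebraic
  \<le> (n-m)/2. The middle inequality uses a real Jordan form, available because the first half
  shows the spectrum to be real.

  Minors are indexed by lists, not sets, so that rows can be bordered, repeated and permuted without
  renumbering.\<close>

definition minor :: "(nat \<Rightarrow> nat \<Rightarrow> 'a::comm_ring_1) \<Rightarrow> nat list \<Rightarrow> nat list \<Rightarrow> 'a" where
  "minor A is js = det (mat (length is) (length is) (\<lambda>(a, b). A (is ! a) (js ! b)))"

definition remove_nth :: "nat \<Rightarrow> 'b list \<Rightarrow> 'b list" where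
  "remove_nth a xs = take a xs @ drop (Suc a) xs"

lemma length_remove_nth [simp]: "a < length xs \<Longrightarrow> length (remove_nth a xs) = length xs - 1"
  by (simp add: remove_nth_def)

lemma nth_remove_nth: "a < length xs \<Longrightarrow> i < length xs - 1 \<Longrightarrow> remove_nth a xs ! i = xs ! insert_index a i"
  by (auto simp: remove_nth_def nth_append insert_index_def min_def)

lemma set_remove_nth: "set (remove_nth a xs) \<subseteq> set xs"
  unfolding remove_nth_def by (metis set_take_subset set_drop_subset set_append Un_subset_iff)

lemma sorted_remove_nth: "sorted_wrt (<) xs \<Longrightarrow> sorted_wrt (<) (remove_nth a (xs :: nat list))"
proof -
  assume s: "sorted_wrt (<) xs"
  have "sorted_wrt (<) (take a xs @ drop a xs)" using s by simp
  moreover have "set (drop (Suc a) xs) \<subseteq> set (drop a xs)"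
    by (simp add: set_drop_subset_set_drop)
  ultimately show ?thesis unfolding remove_nth_def sorted_wrt_append
    using sorted_wrt_drop[OF s] by blast
qed

lemma minor_cong:
  assumes "length is = length is'"
    and "\<And>a b. a < length is \<Longrightarrow> b < length is \<Longrightarrow> A (is ! a) (js ! b) = B (is' ! a) (js' ! b)"
  shows "minor A is js = minor B is' js'"
  unfolding minor_def assms(1)[symmetric] using assms(2)
  by (intro arg_cong[of _ _ det] eq_matI) auto

lemma minor_Nil [simp]: "minor A [] js = 1"
  unfolding minor_def by (intro det_dim_zero) auto

lemma minor_single [simp]: "minor A [i] [j] = A i j"
  unfolding minor_def by (subst det_single) auto

lemma minor_transpose:
  assumes "length is = length js"
  shows "minor (\<lambda>i j. A j i) is js = minor A js is"
proof -
  have "minor (\<lambda>i j. A j i) is js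
      = det (transpose_mat (mat (length is) (length is) (\<lambda>(a, b). A (js ! a) (is ! b))))"
    unfolding minor_def by (intro arg_cong[of _ _ det] eq_matI) auto
  also have "\<dots> = minor A js is"
    unfolding minor_def assms by (rule det_transpose) auto
  finally show ?thesis .
qed

lemma minor_laplace_row:
  assumes "a < length is" "length js = length is"
  shows "minor A is js = (\<Sum>b<length is. (-1)^(a+b) * A (is ! a) (js ! b) * minor A (remove_nth a is) (remove_nth b js))"
proof -
  let ?M = "mat (length is) (length is) (\<lambda>(a, b). A (is ! a) (js ! b))"
  have "det (mat_delete ?M a b) = minor A (remove_nth a is) (remove_nth b js)" if "b < length is" for b
    unfolding minor_def
    using assms that
    by (intro arg_cong[of _ _ det] eq_matI) (auto simp: mat_delete_def nth_remove_nth insert_index_def)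
  then show ?thesis
    unfolding minor_def[of A "is" js]
    by (subst laplace_expansion_row[of _ "length is" a])
       (use assms in \<open>auto simp: cofactor_def intro!: sum.cong\<close>)
qed

lemma minor_laplace_col:
  assumes "b < length is" "length js = length is"
  shows "minor A is js = (\<Sum>a<length is. (-1)^(a+b) * A (is ! a) (js ! b) * minor A (remove_nth a is) (remove_nth b js))"
proof -
  have "minor A is js = minor (\<lambda>i j. A j i) js is"
    using minor_transpose[of js "is" A] assms by simp
  also have "\<dots> = (\<Sum>a<length is. (-1)^(a+b) * A (is ! a) (js ! b) * minor A (remove_nth a is) (remove_nth b js))"
  proof (subst minor_laplace_row[of b], goal_cases)
    case 3
    have "minor (\<lambda>i j. A j i) (remove_nth b js) (remove_nth a is) = minor A (remove_nth a is) (remove_nth b js)" if "a < length is" for a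
      by (rule minor_transpose) (use assms that in simp)
    then show ?case using assms by (intro sum.cong) (auto simp: add.commute)
  qed (use assms in auto)
  finally show ?thesis .
qed

lemma minor_repeat:
  assumes "\<not> distinct is"
  shows "minor A is js = 0"
proof -
  from assms obtain i j where ij: "i < length is" "j < length is" "i \<noteq> j" "is ! i = is ! j"
    unfolding distinct_conv_nth by auto
  show ?thesis unfolding minor_def
    by (rule det_identical_rows[OF _ ij(3,1,2)]) (auto simp: ij intro!: eq_vecI)
qed

lemma minor_zero_col:
  assumes "b < length is" "length js = length is" "\<And>i. i \<in> set is \<Longrightarrow> A i (js ! b) = 0"
  shows "minor A is js = 0"
  using assms by (subst minor_laplace_col[of b]) auto

lemma minor_row_linear:
  assumes "length is = length js" "a < length is"
    and "\<And>j. j \<in> set js \<Longrightarrow> B (is ! a) j = A (is ! a) j + c * A r j"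
    and "\<And>i j. i \<in> set (remove_nth a is) \<Longrightarrow> j \<in> set js \<Longrightarrow> B i j = A i j"
  shows "minor B is js = minor A is js + c * minor A (is[a := r]) js"
proof -
  have d: "remove_nth a (is[a := r]) = remove_nth a is" unfolding remove_nth_def by simp
  have eq: "minor B (remove_nth a is) (remove_nth b js) = minor A (remove_nth a is) (remove_nth b js)" if "b < length is" for b
  proof (rule minor_cong)
    fix x y assume "x < length (remove_nth a is)" "y < length (remove_nth a is)"
    then have "remove_nth a is ! x \<in> set (remove_nth a is)" "remove_nth b js ! y \<in> set js"
      using assms(1,2) that nth_mem[of y "remove_nth b js"] set_remove_nth[of b js] by (auto intro: nth_mem)
    then show "B (remove_nth a is ! x) (remove_nth b js ! y) = A (remove_nth a is ! x) (remove_nth b js ! y)"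
      using assms(4) by blast
  qed simp
  show ?thesis
    using assms by (subst (1 2 3) minor_laplace_row[of a])
      (auto simp: d eq algebra_simps sum.distrib sum_distrib_left intro!: sum.cong)
qed

lemma minor_top_pivot:
  assumes "length is = length js" "\<And>i. i \<in> set is \<Longrightarrow> A i j = 0"
  shows "minor A (x # is) (j # js) = A x j * minor A is js"
proof -
  have "minor A (x # is) (j # js) = (\<Sum>a<Suc (length is). (-1)^a * A ((x # is) ! a) j * minor A (remove_nth a (x # is)) js)"
    using assms(1) by (subst minor_laplace_col[of 0]) (auto simp: remove_nth_def)
  also have "\<dots> = A x j * minor A is js"
    using assms(2) by (subst sum.lessThan_Suc_shift) (auto simp: remove_nth_def)
  finally show ?thesis .
qed

lemma minor_two:
  assumes "length is + 1 = length js" "\<And>i. i \<in> set is \<Longrightarrow> A i j = 0"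
  shows "minor A (x # y # is) (j # js) = A x j * minor A (y # is) js - A y j * minor A (x # is) js"
proof -
  have "minor A (x # y # is) (j # js) = (\<Sum>a<Suc (Suc (length is)). (-1)^a * A ((x # y # is) ! a) j * minor A (remove_nth a (x # y # is)) js)"
    using assms(1) by (subst minor_laplace_col[of 0]) (auto simp: remove_nth_def)
  also have "\<dots> = A x j * minor A (y # is) js - A y j * minor A (x # is) js"
    using assms(2) by (subst sum.lessThan_Suc_shift, subst sum.lessThan_Suc_shift) (auto simp: remove_nth_def)
  finally show ?thesis .
qed

section \<open>Total nonnegativity\<close>

lemma remove_nth_middle: "remove_nth (length T) (T @ w # U) = T @ U"
  by (simp add: remove_nth_def)

lemma minor_repeat_col:
  assumes "\<not> distinct js" "length is = length js"
  shows "minor A is js = 0"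
  using minor_transpose[OF assms(2), of "\<lambda>i j. A j i"] minor_repeat[OF assms(1)] by simp

lemma minor_expand_middle:
  assumes "length js = length T + length U + 1"
  shows "minor A (T @ w # U) js
    = (\<Sum>b<length js. (-1)^(length T + b) * A w (js ! b) * minor A (T @ U) (remove_nth b js))"
  using assms by (subst minor_laplace_row[of "length T"]) (auto simp: remove_nth_middle)

section \<open>The Pluecker relation\<close>

lemma minor_move_row:
  assumes "length js = length T + length U + 1"
  shows "minor A (T @ w # U) js = (-1) ^ length T * minor A (w # T @ U) js"
proof -
  have 2: "minor A (w # T @ U) js = (\<Sum>b<length js. (-1)^b * A w (js ! b) * minor A (T @ U) (remove_nth b js))"
    using minor_expand_middle[of js "[]" "T @ U" A w] assms by (simp del: sum.lessThan_Suc)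
  show ?thesis
    unfolding minor_expand_middle[OF assms] 2 sum_distrib_left
    by (simp add: power_add mult.assoc del: sum.lessThan_Suc)
qed

text \<open>Adjoining to the columns \<open>J\<close> a copy of one of them gives determinant zero.
  Expanding along the copy and adding up with the weights \<open>C l\<close> yields the
  claim.\<close>

lemma sum_column_combination_zero:
  assumes "length J + 1 = length R" and "\<And>w. w \<in> set R \<Longrightarrow> \<phi> w = (\<Sum>l<length J. C l * A w (J ! l))"
  shows "(\<Sum>a<length R. (-1)^a * \<phi> (R ! a) * minor A (remove_nth a R) J) = 0"
proof -
  have z: "(\<Sum>a<length R. (-1)^a * A (R ! a) (J ! l) * minor A (remove_nth a R) J) = 0" if "l < length J" for l
  proof -
    have "minor A R (J ! l # J) = (\<Sum>a<length R. (-1)^a * A (R ! a) (J ! l) * minor A (remove_nth a R) J)"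
      using assms(1) by (subst minor_laplace_col[of 0]) (auto simp: remove_nth_def)
    moreover have "minor A R (J ! l # J) = 0"
      using that assms(1) by (intro minor_repeat_col) auto
    ultimately show ?thesis by simp
  qed
  have "(\<Sum>a<length R. (-1)^a * \<phi> (R ! a) * minor A (remove_nth a R) J)
      = (\<Sum>a<length R. \<Sum>l<length J. C l * ((-1)^a * A (R ! a) (J ! l) * minor A (remove_nth a R) J))"
    using assms(2) by (auto simp: sum_distrib_left sum_distrib_right algebra_simps intro!: sum.cong)
  also have "\<dots> = (\<Sum>l<length J. C l * (\<Sum>a<length R. (-1)^a * A (R ! a) (J ! l) * minor A (remove_nth a R) J))"
    by (subst sum.swap) (simp add: sum_distrib_left)
  also have "\<dots> = 0" using z by simp
  finally show ?thesis .
qed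

text \<open>Laplace expansion along \<open>w\<close>: the cofactors do not depend on
  \<open>w\<close>, and the omitted column \<open>b\<close> gets weight 0. This is the shape
  required of \<open>\<phi>\<close> in \<open>sum_column_combination_zero\<close>.\<close>

lemma minor_linear_in_row:
  assumes "length J = length T + length U + 2" "b < length J"
  shows "\<exists>C. \<forall>w. minor A (T @ w # U) (remove_nth b J) = (\<Sum>l<length J. C l * A w (J ! l))"
proof -
  let ?k = "length J - 1"
  define c where "c b' = (-1)^(length T + b') * minor A (T @ U) (remove_nth b' (remove_nth b J))" for b'
  have "minor A (T @ w # U) (remove_nth b J)
      = (\<Sum>l<length J. (if l = b then 0 else c (delete_index b l)) * A w (J ! l))" for w
  proof -
    have "minor A (T @ w # U) (remove_nth b J) = (\<Sum>b'<?k. c b' * A w (J ! insert_index b b'))"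
      using assms by (subst minor_expand_middle) (auto simp: c_def nth_remove_nth algebra_simps intro!: sum.cong)
    also have "\<dots> = (\<Sum>b'<?k. (\<lambda>l. (if l = b then 0 else c (delete_index b l)) * A w (J ! l)) (insert_index b b'))"
      by (intro sum.cong refl) (auto simp: insert_index_def delete_index_def)
    also have "\<dots> = (\<Sum>l\<in>insert_index b ` {..<?k}. (if l = b then 0 else c (delete_index b l)) * A w (J ! l))"
      by (simp only: sum.reindex[OF insert_index_inj_on] o_def)
    also have "\<dots> = (\<Sum>l<length J. (if l = b then 0 else c (delete_index b l)) * A w (J ! l))"
    proof (rule sum.mono_neutral_left)
      show "insert_index b ` {..<?k} \<subseteq> {..<length J}" by (auto simp: insert_index_def)
      show "\<forall>l\<in>{..<length J} - insert_index b ` {..<?k}. (if l = b then 0 else c (delete_index b l)) * A w (J ! l) = 0"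
      proof
        fix l assume l: "l \<in> {..<length J} - insert_index b ` {..<?k}"
        have "l = b"
        proof (rule ccontr)
          assume "l \<noteq> b"
          then have "l = insert_index b (delete_index b l)" by (simp add: insert_delete_index)
          moreover have "delete_index b l < ?k" using \<open>l \<noteq> b\<close> l assms(2) by (auto simp: delete_index_def)
          ultimately show False using l by blast
        qed
        then show "(if l = b then 0 else c (delete_index b l)) * A w (J ! l) = 0" by simp
      qed
    qed simp
    finally show ?thesis .
  qed
  then show ?thesis by (intro exI allI)
qed

text \<open>\<open>sum_column_combination_zero\<close> is applied to the rows
  \<open>t # T @ u # v # U\<close> with \<open>\<phi> w\<close> the minor through
  \<open>T @ w # U\<close>. A row of \<open>T\<close> or \<open>U\<close> in place of
  \<open>w\<close> is a repetition, so only the terms of \<open>t\<close>, \<open>u\<close> and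
  \<open>v\<close> survive; the sign of moving \<open>t\<close> past \<open>T\<close>
  cancels.\<close>

lemma pluecker:
  fixes A :: "nat \<Rightarrow> nat \<Rightarrow> 'a::idom"
  assumes J: "length J = length T + length U + 2" "b < length J"
  shows "minor A (T @ u # U) (remove_nth b J) * minor A (t # T @ v # U) J
       - minor A (T @ v # U) (remove_nth b J) * minor A (t # T @ u # U) J
       = minor A (t # T @ U) (remove_nth b J) * minor A (T @ u # v # U) J"
proof -
  define \<phi> where "\<phi> w = minor A (T @ w # U) (remove_nth b J)" for w
  obtain C where C: "\<And>w. \<phi> w = (\<Sum>l<length J. C l * A w (J ! l))"
    using minor_linear_in_row[OF J, of A] unfolding \<phi>_def by blast
  let ?R = "t # T @ u # v # U"
  let ?n = "length T"
  let ?f = "\<lambda>a. (-1)^a * \<phi> (?R ! a) * minor A (remove_nth a ?R) J"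
  have rep: "\<phi> w = 0" if "w \<in> set T \<union> set U" for w
    unfolding \<phi>_def using that by (intro minor_repeat) auto
  have "0 = (\<Sum>a<length ?R. ?f a)"
    using sum_column_combination_zero[of J ?R \<phi> C A] C J by simp
  also have "\<dots> = (\<Sum>a\<in>{0, Suc ?n, Suc (Suc ?n)}. ?f a)"
  proof (rule sum.mono_neutral_right)
    show "\<forall>a\<in>{..<length ?R} - {0, Suc ?n, Suc (Suc ?n)}. ?f a = 0"
    proof
      fix a assume a: "a \<in> {..<length ?R} - {0, Suc ?n, Suc (Suc ?n)}"
      then have "?R ! a \<in> set T \<union> set U"
        by (cases a) (auto simp: nth_append nth_Cons' intro!: nth_mem)
      then show "?f a = 0" using rep by simp
    qed
  qed auto
  also have "\<dots> = \<phi> t * minor A (T @ u # v # U) J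
      + (-1)^Suc ?n * \<phi> u * minor A (t # T @ v # U) J + (-1)^Suc (Suc ?n) * \<phi> v * minor A (t # T @ u # U) J"
    by (simp add: remove_nth_def nth_append)
  also have "\<phi> t = (-1) ^ ?n * minor A (t # T @ U) (remove_nth b J)"
    unfolding \<phi>_def using J by (intro minor_move_row) simp
  finally have "(-1) ^ ?n * (minor A (t # T @ U) (remove_nth b J) * minor A (T @ u # v # U) J
      - \<phi> u * minor A (t # T @ v # U) J + \<phi> v * minor A (t # T @ u # U) J) = 0"
    by (simp add: algebra_simps)
  then have "minor A (t # T @ U) (remove_nth b J) * minor A (T @ u # v # U) J
      - \<phi> u * minor A (t # T @ v # U) J + \<phi> v * minor A (t # T @ u # U) J = 0"
    by simp
  then show ?thesis unfolding \<phi>_def by (simp add: algebra_simps)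
qed

section \<open>Totally nonnegative functions and minors through adjacent rows\<close>

definition tn :: "nat \<Rightarrow> (nat \<Rightarrow> nat \<Rightarrow> real) \<Rightarrow> bool" where
  "tn N A \<longleftrightarrow> (\<forall>is js. length is = length js \<longrightarrow> sorted_wrt (<) is \<longrightarrow> sorted_wrt (<) js \<longrightarrow>
      set is \<subseteq> {..<N} \<longrightarrow> set js \<subseteq> {..<N} \<longrightarrow> 0 \<le> minor A is js)"

lemma tnD:
  assumes "tn N A" "length is = length js" "sorted_wrt (<) is" "sorted_wrt (<) js"
    "set is \<subseteq> {..<N}" "set js \<subseteq> {..<N}"
  shows "0 \<le> minor A is js"
  using assms unfolding tn_def by blast

lemma tn_entry: "tn N A \<Longrightarrow> i < N \<Longrightarrow> j < N \<Longrightarrow> 0 \<le> A i j"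
  using tnD[of N A "[i]" "[j]"] by simp

lemma minor_2: "minor A [i, k] [j, l] = A i j * A k l - A i l * A k j"
  by (subst minor_laplace_row[of 0]) (auto simp: remove_nth_def numeral_2_eq_2)

lemma tn_2:
  assumes "tn N A" "i < k" "k < N" "j < l" "l < N"
  shows "A i l * A k j \<le> A i j * A k l"
  using tnD[of N A "[i, k]" "[j, l]"] assms by (simp add: minor_2)

lemma tn_transpose: "tn N A \<Longrightarrow> tn N (\<lambda>i j. A j i)"
  unfolding tn_def by (metis minor_transpose)

text \<open>The rows of \<open>T\<close> are removed one at a time, each with a suitable column. By the Pluecker relation
  this can only decrease the ratio of the minor through row \<open>Suc k\<close> to the one through row \<open>k\<close>. If every
  choice of the column makes the smaller minor through row \<open>k\<close> vanish, then so does the larger one.\<close>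

lemma minor_neville:
  assumes tn: "tn N A" and k: "Suc k < N" and j0: "j0 < N"
    and z1: "\<And>l. Suc k < l \<Longrightarrow> l < N \<Longrightarrow> A l j0 = 0"
    and z2: "\<And>l j. k \<le> l \<Longrightarrow> l < N \<Longrightarrow> j < j0 \<Longrightarrow> A l j = 0"
    and pos: "0 < A k j0"
    and U: "sorted_wrt (<) U" "set U \<subseteq> {Suc k<..<N}"
    and T: "sorted_wrt (<) T" "set T \<subseteq> {..<k}"
    and J: "sorted_wrt (<) J" "set J \<subseteq> {..<N}" "length J = length T + length U + 1"
  shows "A (Suc k) j0 * minor A (T @ k # U) J \<le> A k j0 * minor A (T @ Suc k # U) J"
  using T J
proof (induction T arbitrary: J)
  case Nil
  then obtain j J' where JJ: "J = j # J'" by (cases J) auto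
  have len: "length U = length J'" using Nil JJ by simp
  have sJ': "sorted_wrt (<) J'" "set J' \<subseteq> {j<..<N}" "j < N" using Nil JJ by auto
  \<comment> \<open>Here \<open>j\<close> is the first column. To the left of \<open>j0\<close> both
    minors have a zero column; at \<open>j0\<close> both contain the same factor, the minor of
    \<open>U\<close>; to the right of \<open>j0\<close>, the minor with rows \<open>k\<close>,
    \<open>Suc k\<close>, \<open>U\<close> and the extra column \<open>j0\<close> is nonnegative,
    and its expansion along \<open>j0\<close> is the claim.\<close>
  consider "j < j0" | "j = j0" | "j0 < j" by linarith
  then show ?case
  proof cases
    case 1
    have "minor A (x # U) J = 0" if "x = Suc k \<or> x = k" for x
    proof (rule minor_zero_col[of 0])
      fix l assume "l \<in> set (x # U)"
      then have "k \<le> l" "l < N" using that k by (auto dest!: subsetD[OF U(2)])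
      then show "A l (J ! 0) = 0" using z2[of l j] 1 by (simp add: JJ)
    qed (use len in \<open>auto simp: JJ\<close>)
    then show ?thesis by simp
  next
    case 2
    have "minor A (x # U) J = A x j0 * minor A U J'" for x
      unfolding JJ 2 using z1 U len by (intro minor_top_pivot) auto
    then show ?thesis by simp
  next
    case 3
    have "0 \<le> minor A (k # Suc k # U) (j0 # J)"
      using k U(1) 3 sJ' j0 len by (intro tnD[OF tn]) (auto simp: JJ dest!: subsetD[OF U(2)])
    also have "\<dots> = A k j0 * minor A (Suc k # U) J - A (Suc k) j0 * minor A (k # U) J"
      using z1 U len by (intro minor_two) (auto simp: JJ)
    finally show ?thesis by simp
  qed
next
  case (Cons t T)
  have st: "sorted_wrt (<) (T @ x # U)" "set (T @ x # U) \<subseteq> {..<N}" if "x = Suc k \<or> x = k" for x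
    using that Cons.prems(1) U(1) U(2) Cons.prems(2) k by (force simp: sorted_wrt_append)+
  have st': "sorted_wrt (<) (t # T @ U)" "set (t # T @ U) \<subseteq> {..<N}"
    using Cons.prems(1) U(1) U(2) Cons.prems(2) k by (force simp: sorted_wrt_append)+
  have st1: "sorted_wrt (<) (t # T @ x # U)" "set (t # T @ x # U) \<subseteq> {..<N}" if "x = Suc k \<or> x = k" for x
    using that Cons.prems(1) U(1) U(2) Cons.prems(2) k by (force simp: sorted_wrt_append)+
  have st2: "sorted_wrt (<) (T @ k # Suc k # U)" "set (T @ k # Suc k # U) \<subseteq> {..<N}"
    using Cons.prems(1) U(1) U(2) Cons.prems(2) k by (force simp: sorted_wrt_append)+
  have dJ: "sorted_wrt (<) (remove_nth b J)" "set (remove_nth b J) \<subseteq> {..<N}" for b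
    using Cons.prems sorted_remove_nth set_remove_nth[of b J] by auto
  let ?F = "\<lambda>x. minor A (t # T @ x # U) J"
  have F0: "0 \<le> ?F x" if "x = Suc k \<or> x = k" for x
    using st1[OF that] Cons.prems by (intro tnD[OF tn]) auto
  show ?case
  proof (cases "?F k = 0")
    case True
    then show ?thesis using F0[of "Suc k"] pos by simp
  next
    case False
    let ?f = "\<lambda>b x. minor A (T @ x # U) (remove_nth b J)"
    have "?F k = (\<Sum>b<length J. (-1)^(0+b) * A t (J ! b) * ?f b k)"
      using Cons.prems by (subst minor_laplace_row[of 0]) (auto simp: remove_nth_def)
    then obtain b where b: "b < length J" "?f b k \<noteq> 0"
      using False by (metis (no_types, lifting) lessThan_iff mult_zero_right sum.neutral)
    have f0: "0 \<le> ?f b x" if "x = Suc k \<or> x = k" for x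
      using st[OF that] Cons.prems dJ b by (intro tnD[OF tn]) auto
    have fpos: "0 < ?f b k" using b f0[of k] by simp
    have IH: "A (Suc k) j0 * ?f b k \<le> A k j0 * ?f b (Suc k)"
      using Cons.prems dJ b by (intro Cons.IH) auto
    have "0 \<le> minor A (t # T @ U) (remove_nth b J) * minor A (T @ k # Suc k # U) J"
      using st' st2 Cons.prems dJ b by (intro mult_nonneg_nonneg tnD[OF tn]) auto
    moreover have "?f b k * ?F (Suc k) - ?f b (Suc k) * ?F k
        = minor A (t # T @ U) (remove_nth b J) * minor A (T @ k # Suc k # U) J"
      using Cons.prems b by (intro pluecker) auto
    ultimately have P: "?f b (Suc k) * ?F k \<le> ?f b k * ?F (Suc k)" by linarith
    have "?f b k * (A (Suc k) j0 * ?F k) \<le> A k j0 * (?f b (Suc k) * ?F k)"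
      using mult_right_mono[OF IH F0[of k]] by (simp add: mult_ac)
    also have "\<dots> \<le> A k j0 * (?f b k * ?F (Suc k))"
      using P pos by (intro mult_left_mono) auto
    also have "\<dots> = ?f b k * (A k j0 * ?F (Suc k))" by simp
    finally show ?thesis using fpos by (simp add: mult_le_cancel_left)
  qed
qed

section \<open>Neville elimination\<close>

definition fmat :: "nat \<Rightarrow> (nat \<Rightarrow> nat \<Rightarrow> 'a) \<Rightarrow> 'a mat" where
  "fmat N A = mat N N (\<lambda>(i, j). A i j)"

lemma fmat_carrier [simp]: "fmat N A \<in> carrier_mat N N"
  by (simp add: fmat_def)

definition row_sub :: "nat \<Rightarrow> real \<Rightarrow> (nat \<Rightarrow> nat \<Rightarrow> real) \<Rightarrow> nat \<Rightarrow> nat \<Rightarrow> real" where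
  "row_sub i c A = (\<lambda>k j. if k = i then A i j - c * A (i - 1) j else A k j)"

text \<open>Right multiplication by the inverse of the elementary matrix that acts from the left in
  \<open>row_sub\<close>, so that \<open>col_add i c (row_sub i c A)\<close> is similar to
  \<open>A\<close>.\<close>

definition col_add :: "nat \<Rightarrow> real \<Rightarrow> (nat \<Rightarrow> nat \<Rightarrow> real) \<Rightarrow> nat \<Rightarrow> nat \<Rightarrow> real" where
  "col_add i c A = (\<lambda>k j. if j = i - 1 then A k (i - 1) + c * A k i else A k j)"

text \<open>Only minors through row \<open>i\<close> change. Such a minor loses \<open>c\<close>
  times the one with \<open>i\<close> replaced by \<open>i - 1\<close>: this is zero if row
  \<open>i - 1\<close> occurs already, and otherwise \<open>minor_neville\<close> bounds it,
  \<open>c\<close> being the quotient of the two entries in column \<open>j0\<close>.\<close>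

lemma tn_neville:
  assumes tn: "tn N A" and i: "0 < i" "i < N" and j0: "j0 < N"
    and z1: "\<And>k. i < k \<Longrightarrow> k < N \<Longrightarrow> A k j0 = 0"
    and z2: "\<And>k j. i - 1 \<le> k \<Longrightarrow> k < N \<Longrightarrow> j < j0 \<Longrightarrow> A k j = 0"
    and pos: "0 < A (i - 1) j0"
  shows "tn N (row_sub i (A i j0 / A (i - 1) j0) A)"
  unfolding tn_def
proof (intro allI impI)
  fix "is" js :: "nat list"
  assume len: "length is = length js" and s: "sorted_wrt (<) is" "sorted_wrt (<) js"
    and r: "set is \<subseteq> {..<N}" "set js \<subseteq> {..<N}"
  define c where "c = A i j0 / A (i - 1) j0"
  let ?B = "row_sub i c A"
  have "0 \<le> minor ?B is js"
  proof (cases "i \<in> set is")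
    case False
    then have "minor ?B is js = minor A is js"
      by (intro minor_cong) (auto simp: row_sub_def in_set_conv_nth)
    then show ?thesis using tnD[OF tn len s r] by simp
  next
    case True
    then obtain T U where TU: "is = T @ i # U" by (meson split_list)
    have T: "sorted_wrt (<) T" "set T \<subseteq> {..<i}" and U: "sorted_wrt (<) U" "set U \<subseteq> {i<..<N}"
      using s(1) r(1) by (auto simp: TU sorted_wrt_append)
    have "minor ?B is js = minor A is js + (-c) * minor A (is[length T := i - 1]) js"
    proof (rule minor_row_linear)
      fix k j assume "k \<in> set (remove_nth (length T) is)"
      then have "k \<noteq> i" using T U by (auto simp: TU remove_nth_middle)
      then show "?B k j = A k j" by (simp add: row_sub_def)
    qed (use len in \<open>auto simp: TU row_sub_def\<close>)
    also have "is[length T := i - 1] = T @ (i - 1) # U" by (simp add: TU)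
    finally have eq: "minor ?B is js = minor A (T @ i # U) js - c * minor A (T @ (i - 1) # U) js"
      by (simp add: TU)
    show ?thesis
    proof (cases "i - 1 \<in> set T")
      case True
      then have "minor A (T @ (i - 1) # U) js = 0" by (intro minor_repeat) auto
      then show ?thesis using tnD[OF tn len s r] unfolding eq by (simp add: TU)
    next
      case False
      have T': "set T \<subseteq> {..<i - 1}"
      proof
        fix x assume x: "x \<in> set T"
        have "x \<noteq> i - 1" using False x by blast
        moreover have "x < i" using T(2) x by blast
        ultimately show "x \<in> {..<i - 1}" by simp
      qed
      have Si: "Suc (i - 1) = i" using i by simp
      have lJ: "length js = length T + length U + 1" using len by (simp add: TU)
      have "A i j0 * minor A (T @ (i - 1) # U) js \<le> A (i - 1) j0 * minor A (T @ i # U) js"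
        using minor_neville[of N A "i - 1" j0 U T js, unfolded Si, OF tn i(2) j0 z1 z2 pos U T(1) T' s(2) r(2) lJ] .
      then have "c * minor A (T @ (i - 1) # U) js \<le> minor A (T @ i # U) js"
        unfolding c_def using pos by (simp add: field_simps)
      then show ?thesis unfolding eq by simp
    qed
  qed
  then show "0 \<le> minor (row_sub i (A i j0 / A (i - 1) j0) A) is js" unfolding c_def .
qed

text \<open>The extra term is a minor with \<open>i - 1\<close> replaced by its neighbour
  \<open>i\<close>: the index list remains sorted, or \<open>i\<close> occurs twice and the term is
  zero.\<close>

lemma tn_row_add:
  assumes tn: "tn N A" and i: "0 < i" "i < N" and c: "0 \<le> c"
  shows "tn N (\<lambda>k j. if k = i - 1 then A (i - 1) j + c * A i j else A k j)" (is "tn N ?B")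
  unfolding tn_def
proof (intro allI impI)
  fix "is" js :: "nat list"
  assume len: "length is = length js" and s: "sorted_wrt (<) is" "sorted_wrt (<) js"
    and r: "set is \<subseteq> {..<N}" "set js \<subseteq> {..<N}"
  show "0 \<le> minor ?B is js"
  proof (cases "i - 1 \<in> set is")
    case False
    then have "minor ?B is js = minor A is js"
      by (intro minor_cong) (auto simp: in_set_conv_nth)
    then show ?thesis using tnD[OF tn len s r] by simp
  next
    case True
    then obtain T U where TU: "is = T @ (i - 1) # U" by (meson split_list)
    have T: "sorted_wrt (<) T" "set T \<subseteq> {..<i - 1}" and U: "sorted_wrt (<) U" "set U \<subseteq> {i - 1<..<N}"
      using s(1) r(1) by (auto simp: TU sorted_wrt_append)
    have "minor ?B is js = minor A is js + c * minor A (is[length T := i]) js"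
    proof (rule minor_row_linear)
      fix k j assume "k \<in> set (remove_nth (length T) is)"
      then have "k \<noteq> i - 1" using T U by (auto simp: TU remove_nth_middle)
      then show "?B k j = A k j" by simp
    qed (use len in \<open>auto simp: TU\<close>)
    also have "is[length T := i] = T @ i # U" by (simp add: TU)
    finally have eq: "minor ?B is js = minor A is js + c * minor A (T @ i # U) js" .
    have "0 \<le> minor A (T @ i # U) js"
    proof (cases "i \<in> set U")
      case True
      then have "minor A (T @ i # U) js = 0" by (intro minor_repeat) auto
      then show ?thesis by simp
    next
      case False
      have U': "k > i" if "k \<in> set U" for k
      proof -
        have "k \<noteq> i" using that False by blast
        moreover have "i - 1 < k" using subsetD[OF U(2) that] by simp
        ultimately show ?thesis by linarith
      qed
      have "sorted_wrt (<) (T @ i # U)"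
        using T U U' i by (fastforce simp: sorted_wrt_append)
      moreover have "set (T @ i # U) \<subseteq> {..<N}" using r i by (auto simp: TU)
      ultimately show ?thesis using len s r by (intro tnD[OF tn]) (auto simp: TU)
    qed
    then show ?thesis using tnD[OF tn len s r] c unfolding eq by simp
  qed
qed

lemma tn_col_add:
  assumes "tn N A" "0 < i" "i < N" "0 \<le> c"
  shows "tn N (col_add i c A)"
  using tn_transpose[OF tn_row_add[OF tn_transpose[OF assms(1)] assms(2-)]]
  by (simp add: col_add_def)

lemma minor_map: "minor A (map f is) (map g js) = minor (\<lambda>i j. A (f i) (g j)) is js" if "length is = length js"
  using that by (intro minor_cong) auto

lemma tn_compose:
  assumes "tn N A" "strict_mono_on {..<M} f" "f ` {..<M} \<subseteq> {..<N}"
  shows "tn M (\<lambda>i j. A (f i) (f j))"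
  unfolding tn_def
proof (intro allI impI)
  fix "is" js :: "nat list"
  assume len: "length is = length js" and s: "sorted_wrt (<) is" "sorted_wrt (<) js"
    and r: "set is \<subseteq> {..<M}" "set js \<subseteq> {..<M}"
  have mono: "sorted_wrt (<) (map f xs)" if "sorted_wrt (<) xs" "set xs \<subseteq> {..<M}" for xs
    unfolding sorted_wrt_map
    by (rule sorted_wrt_mono_rel[OF _ that(1)]) (use assms(2) that(2) in \<open>auto dest: strict_mono_onD\<close>)
  have "0 \<le> minor A (map f is) (map f js)"
    using r assms(3) by (intro tnD[OF assms(1)] mono s r) (auto simp: len)
  then show "0 \<le> minor (\<lambda>i j. A (f i) (f j)) is js"
    by (simp add: minor_map len)
qed

lemma strict_mono_insert_index: "strict_mono_on S (insert_index i)"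
  by (auto simp: strict_mono_on_def insert_index_def)

section \<open>Characteristic polynomials under similarity and deletion\<close>

definition char_fun :: "(nat \<Rightarrow> nat \<Rightarrow> 'a::comm_ring_1) \<Rightarrow> nat \<Rightarrow> nat \<Rightarrow> 'a poly" where
  "char_fun A i j = (if i = j then [:- A i j, 1:] else [:- A i j:])"

lemma char_poly_fmat: "char_poly (fmat N A) = minor (char_fun A) [0..<N] [0..<N]"
  unfolding char_poly_def minor_def char_poly_matrix_def fmat_def
  by (intro arg_cong[of _ _ det] eq_matI) (auto simp: char_fun_def)

lemma char_poly_fmat_transpose: "char_poly (fmat N (\<lambda>i j. A j i)) = char_poly (fmat N A)"
proof -
  have "char_fun (\<lambda>i j. A j i) = (\<lambda>i j. char_fun A j i)"
    by (intro ext) (auto simp: char_fun_def)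
  then show ?thesis
    unfolding char_poly_fmat using minor_transpose[of "[0..<N]" "[0..<N]" "char_fun A"] by simp
qed

text \<open>The same two operations are applied to \<open>x I - A\<close>; the multiples of x that
  they create at position \<open>(i, i - 1)\<close> cancel, and neither changes the
  determinant.\<close>

lemma char_poly_neville:
  assumes i: "0 < i" "i < N"
  shows "char_poly (fmat N (col_add i c (row_sub i c A))) = char_poly (fmat N A)"
proof -
  let ?P = "char_poly_matrix (fmat N A)"
  have P: "?P \<in> carrier_mat N N" by simp
  have "char_poly_matrix (fmat N (col_add i c (row_sub i c A)))
      = addcol [:c:] (i - 1) i (addrow [:- c:] i (i - 1) ?P)"
    using i by (intro eq_matI)
      (auto simp: char_poly_matrix_def fmat_def col_add_def row_sub_def algebra_simps)
  then show ?thesis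
    unfolding char_poly_def using i P
    by (simp add: det_addcol[of _ N] det_addrow[of _ N])
qed

lemma remove_nth_upt: "i < N \<Longrightarrow> remove_nth i [0..<N] = map (insert_index i) [0..<N - 1]"
  by (rule nth_equalityI) (auto simp: nth_remove_nth, auto simp: insert_index_def)

lemma char_poly_zero_row:
  assumes i: "i < N" and z: "\<And>j. j < N \<Longrightarrow> A i j = 0"
  shows "char_poly (fmat N A)
       = [:0, 1:] * char_poly (fmat (N - 1) (\<lambda>a b. A (insert_index i a) (insert_index i b)))"
proof -
  have "char_poly (fmat N A) = (\<Sum>b<N. (-1)^(i+b) * char_fun A i b
      * minor (char_fun A) (remove_nth i [0..<N]) (remove_nth b [0..<N]))"
    unfolding char_poly_fmat using i by (subst minor_laplace_row[of i]) auto
  also have "\<dots> = (\<Sum>b\<in>{i}. (-1)^(i+b) * char_fun A i b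
      * minor (char_fun A) (remove_nth i [0..<N]) (remove_nth b [0..<N]))"
    using i z by (intro sum.mono_neutral_right) (auto simp: char_fun_def)
  also have "\<dots> = [:0, 1:] * minor (char_fun A) (remove_nth i [0..<N]) (remove_nth i [0..<N])"
    using i z by (simp add: char_fun_def power_add[symmetric] mult_2[symmetric])
  also have "minor (char_fun A) (remove_nth i [0..<N]) (remove_nth i [0..<N])
      = minor (\<lambda>a b. char_fun A (insert_index i a) (insert_index i b)) [0..<N - 1] [0..<N - 1]"
    using i by (simp add: remove_nth_upt minor_map)
  also have "(\<lambda>a b. char_fun A (insert_index i a) (insert_index i b))
      = char_fun (\<lambda>a b. A (insert_index i a) (insert_index i b))"
    by (intro ext) (auto simp: char_fun_def insert_index_def)
  finally show ?thesis by (simp add: char_poly_fmat)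
qed

section \<open>Eigenspaces under similarity and deletion\<close>

definition eigen_fun :: "nat \<Rightarrow> (nat \<Rightarrow> nat \<Rightarrow> real) \<Rightarrow> real \<Rightarrow> (nat \<Rightarrow> real) \<Rightarrow> bool" where
  "eigen_fun N A x v \<longleftrightarrow> (\<forall>i<N. (\<Sum>j<N. A i j * v j) = x * v i)"

text \<open>Linear dependence of any two solutions expresses dimension at most one without a vector
  space structure. The value 0 is left out because deleting a zero row may lose kernel
  vectors.\<close>

definition thin_eigenspaces :: "nat \<Rightarrow> (nat \<Rightarrow> nat \<Rightarrow> real) \<Rightarrow> bool" where
  "thin_eigenspaces N A \<longleftrightarrow> (\<forall>x v w. x \<noteq> 0 \<longrightarrow> eigen_fun N A x v \<longrightarrow> eigen_fun N A x w \<longrightarrow>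
     (\<exists>\<alpha> \<beta>. (\<alpha> \<noteq> 0 \<or> \<beta> \<noteq> 0) \<and> (\<forall>i<N. \<alpha> * v i + \<beta> * w i = 0)))"

text \<open>The new vector is the image of \<open>v\<close> under the elementary matrix of
  \<open>row_sub\<close>; the column operation undoes that matrix, leaving the product of
  \<open>row_sub i c A\<close> with \<open>v\<close>.\<close>

lemma eigen_fun_neville:
  assumes i: "0 < i" "i < N" and v: "eigen_fun N A x v"
  shows "eigen_fun N (col_add i c (row_sub i c A)) x (v(i := v i - c * v (i - 1)))"
proof -
  let ?R = "row_sub i c A" and ?w = "v(i := v i - c * v (i - 1))"
  have "(\<Sum>j<N. col_add i c ?R k j * ?w j) = (\<Sum>j<N. ?R k j * v j)" for k
  proof -
    have "(\<Sum>j<N. col_add i c ?R k j * ?w j) = (\<Sum>j<N. ?R k j * v j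
        + (if j = i - 1 then c * ?R k i * v (i - 1) else 0) + (if j = i then - c * ?R k i * v (i - 1) else 0))"
      using i by (intro sum.cong) (auto simp: col_add_def algebra_simps)
    also have "\<dots> = (\<Sum>j<N. ?R k j * v j)"
      using i by (simp add: sum.distrib sum.delta less_imp_diff_less)
    finally show ?thesis .
  qed
  moreover have "(\<Sum>j<N. ?R k j * v j) = x * ?w k" if "k < N" for k
    using v i that unfolding eigen_fun_def
    by (auto simp: row_sub_def left_diff_distrib sum_subtractf mult.assoc sum_distrib_left[symmetric] less_imp_diff_less algebra_simps)
  ultimately show ?thesis unfolding eigen_fun_def by simp
qed

lemma thin_eigenspaces_neville:
  assumes i: "0 < i" "i < N" and g: "thin_eigenspaces N (col_add i c (row_sub i c A))"
  shows "thin_eigenspaces N A"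
  unfolding thin_eigenspaces_def
proof (intro allI impI)
  fix x v w assume x: "x \<noteq> 0" and v: "eigen_fun N A x v" and w: "eigen_fun N A x w"
  obtain \<alpha> \<beta> where ab: "\<alpha> \<noteq> 0 \<or> \<beta> \<noteq> 0"
    and e: "\<And>k. k < N \<Longrightarrow> \<alpha> * (v(i := v i - c * v (i - 1))) k + \<beta> * (w(i := w i - c * w (i - 1))) k = 0"
    using g x eigen_fun_neville[OF i v, of c] eigen_fun_neville[OF i w, of c] unfolding thin_eigenspaces_def by blast
  have "\<alpha> * v k + \<beta> * w k = 0" if "k < N" for k
  proof (cases "k = i")
    case True
    have "\<alpha> * v (i - 1) + \<beta> * w (i - 1) = 0" using e[of "i - 1"] i by (cases i) auto
    then have "c * (\<alpha> * v (i - 1) + \<beta> * w (i - 1)) = 0" by simp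
    then show ?thesis using e[of i] i True by (simp add: algebra_simps)
  qed (use e[of k] that in simp)
  then show "\<exists>\<alpha> \<beta>. (\<alpha> \<noteq> 0 \<or> \<beta> \<noteq> 0) \<and> (\<forall>i<N. \<alpha> * v i + \<beta> * w i = 0)" using ab by blast
qed

lemma sum_insert_index:
  assumes "i < N" "f i = (0::real)"
  shows "(\<Sum>j<N. f j) = (\<Sum>j<N - 1. f (insert_index i j))"
proof -
  have "(\<Sum>j<N. f j) = (\<Sum>j\<in>insert i (insert_index i ` {..<N - 1}). f j)"
  proof (rule sum.cong)
    show "{..<N} = insert i (insert_index i ` {..<N - 1})"
    proof (intro equalityI subsetI)
      fix l assume "l \<in> {..<N}"
      then have "l = i \<or> (l = insert_index i (delete_index i l) \<and> delete_index i l < N - 1)"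
        using assms(1) by (auto simp: insert_index_def delete_index_def)
      then show "l \<in> insert i (insert_index i ` {..<N - 1})" by blast
    qed (use assms(1) in \<open>auto simp: insert_index_def\<close>)
  qed simp
  also have "\<dots> = (\<Sum>j\<in>insert_index i ` {..<N - 1}. f j)"
    using assms(2) by (subst sum.insert) (auto simp: insert_index_def split: if_splits)
  also have "\<dots> = (\<Sum>j<N - 1. f (insert_index i j))"
    by (simp only: sum.reindex[OF insert_index_inj_on] o_def)
  finally show ?thesis .
qed

text \<open>For \<open>x \<noteq> 0\<close> the zero row forces the coordinate \<open>i\<close> of
  an eigenvector to vanish, so the remaining coordinates still form a solution for the smaller
  matrix and determine the vector.\<close>

lemma thin_eigenspaces_zero_row:
  assumes i: "i < N" and z: "\<And>j. j < N \<Longrightarrow> A i j = 0"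
    and g: "thin_eigenspaces (N - 1) (\<lambda>a b. A (insert_index i a) (insert_index i b))"
  shows "thin_eigenspaces N A"
  unfolding thin_eigenspaces_def
proof (intro allI impI)
  fix x v w assume x: "x \<noteq> 0" and v: "eigen_fun N A x v" and w: "eigen_fun N A x w"
  have *: "v i = 0 \<and> eigen_fun (N - 1) (\<lambda>a b. A (insert_index i a) (insert_index i b)) x (\<lambda>a. v (insert_index i a))"
    if v: "eigen_fun N A x v" for v
  proof
    show vi: "v i = 0" using v i z x unfolding eigen_fun_def by fastforce
    show "eigen_fun (N - 1) (\<lambda>a b. A (insert_index i a) (insert_index i b)) x (\<lambda>a. v (insert_index i a))"
      unfolding eigen_fun_def
    proof (intro allI impI)
      fix a assume "a < N - 1"
      then have "insert_index i a < N" by (auto simp: insert_index_def)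
      then show "(\<Sum>j<N - 1. A (insert_index i a) (insert_index i j) * v (insert_index i j)) = x * v (insert_index i a)"
        using v vi sum_insert_index[OF i, of "\<lambda>j. A (insert_index i a) j * v j"] unfolding eigen_fun_def by simp
    qed
  qed
  obtain \<alpha> \<beta> where ab: "\<alpha> \<noteq> 0 \<or> \<beta> \<noteq> 0"
    and e: "\<And>k. k < N - 1 \<Longrightarrow> \<alpha> * v (insert_index i k) + \<beta> * w (insert_index i k) = 0"
    using g x *[OF v] *[OF w] unfolding thin_eigenspaces_def by blast
  have "\<alpha> * v k + \<beta> * w k = 0" if "k < N" for k
  proof (cases "k = i")
    case True
    then show ?thesis using *[OF v] *[OF w] by simp
  next
    case False
    then have "k = insert_index i (delete_index i k)" "delete_index i k < N - 1"
      using that i by (auto simp: insert_index_def delete_index_def)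
    then show ?thesis using e by metis
  qed
  then show "\<exists>\<alpha> \<beta>. (\<alpha> \<noteq> 0 \<or> \<beta> \<noteq> 0) \<and> (\<forall>i<N. \<alpha> * v i + \<beta> * w i = 0)" using ab by blast
qed

section \<open>Reduction to Hessenberg form\<close>

text \<open>\<open>d\<close> counts the deleted zero rows. Thinness travels backwards, from the
  reduced matrix to the original one.\<close>

definition reduces_to :: "nat \<Rightarrow> (nat \<Rightarrow> nat \<Rightarrow> real) \<Rightarrow> nat \<Rightarrow> (nat \<Rightarrow> nat \<Rightarrow> real) \<Rightarrow> bool" where
  "reduces_to N A N' A' \<longleftrightarrow> (\<exists>d. char_poly (fmat N A) = [:0, 1:] ^ d * char_poly (fmat N' A'))
     \<and> (thin_eigenspaces N' A' \<longrightarrow> thin_eigenspaces N A)"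

lemma reduces_to_refl: "reduces_to N A N A"
  unfolding reduces_to_def by (auto intro: exI[of _ 0])

lemma reduces_to_trans:
  assumes "reduces_to N A N1 B" "reduces_to N1 B N2 C"
  shows "reduces_to N A N2 C"
proof -
  obtain d d' where "char_poly (fmat N A) = [:0, 1:] ^ d * char_poly (fmat N1 B)"
    "char_poly (fmat N1 B) = [:0, 1:] ^ d' * char_poly (fmat N2 C)"
    using assms unfolding reduces_to_def by blast
  then have "char_poly (fmat N A) = [:0, 1:] ^ (d + d') * char_poly (fmat N2 C)"
    by (simp add: power_add mult.assoc)
  then show ?thesis using assms unfolding reduces_to_def by blast
qed

lemma reduces_to_neville:
  "0 < i \<Longrightarrow> i < N \<Longrightarrow> reduces_to N A N (col_add i c (row_sub i c A))"
  unfolding reduces_to_def using char_poly_neville[of i N c A] thin_eigenspaces_neville[of i N c A]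
  by (auto intro!: exI[of _ 0])

lemma reduces_to_zero_row:
  assumes "i < N" "\<And>j. j < N \<Longrightarrow> A i j = 0"
  shows "reduces_to N A (N - 1) (\<lambda>a b. A (insert_index i a) (insert_index i b))"
  unfolding reduces_to_def using char_poly_zero_row[of i N A] thin_eigenspaces_zero_row[of i N A] assms
  by (auto intro!: exI[of _ 1])

text \<open>The flag \<open>e\<close> says that the last column is \<open>\<kappa>\<close> times the last unit vector, which
  exempts the last superdiagonal entry; \<open>f\<close> says that the matrix is lower Hessenberg.\<close>

definition irreducible_tn :: "bool \<Rightarrow> real \<Rightarrow> bool \<Rightarrow> nat \<Rightarrow> (nat \<Rightarrow> nat \<Rightarrow> real) \<Rightarrow> bool" where
  "irreducible_tn e \<kappa> f N A \<longleftrightarrow> tn N A \<and> (\<forall>i. i + 1 < N \<longrightarrow> 0 < A (i + 1) i)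
     \<and> (\<forall>i. i + 1 < N \<longrightarrow> \<not> (e \<and> i + 2 = N) \<longrightarrow> 0 < A i (i + 1))
     \<and> (e \<longrightarrow> 0 < N \<and> 0 < \<kappa> \<and> A (N - 1) (N - 1) = \<kappa> \<and> (\<forall>i. i + 1 < N \<longrightarrow> A i (N - 1) = 0))
     \<and> (f \<longrightarrow> (\<forall>i j. i + 1 < j \<longrightarrow> j < N \<longrightarrow> A i j = 0))"

text \<open>Adjacent 2 x 2 minors bound the product of two neighbouring diagonal entries below by a
  product of a sub- and a superdiagonal entry. The bound \<open>3 \<le> N\<close> matters: for
  \<open>N = 2\<close> with \<open>e\<close> set, no positive superdiagonal entry protects the first
  diagonal entry.\<close>

lemma irreducible_tn_diag_pos:
  assumes "irreducible_tn e \<kappa> f N A" "3 \<le> N" "i < N"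
  shows "0 < A i i"
proof -
  have tn: "tn N A" and sub: "\<And>i. i + 1 < N \<Longrightarrow> 0 < A (i + 1) i"
    and sup: "\<And>i. i + 1 < N \<Longrightarrow> \<not> (e \<and> i + 2 = N) \<Longrightarrow> 0 < A i (i + 1)"
    and e: "e \<Longrightarrow> 0 < A (N - 1) (N - 1)"
    using assms(1) unfolding irreducible_tn_def by auto
  have *: "0 < A k k \<and> 0 < A (k + 1) (k + 1)" if "k + 1 < N" "\<not> (e \<and> k + 2 = N)" for k
  proof -
    have "0 < A k (k + 1) * A (k + 1) k" using sub sup that by simp
    also have "\<dots> \<le> A k k * A (k + 1) (k + 1)" using that by (intro tn_2[OF tn]) auto
    finally show ?thesis
      using tn_entry[OF tn, of k k] tn_entry[OF tn, of "k+1" "k+1"] that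
      by (auto simp: zero_less_mult_iff)
  qed
  consider "e \<and> i = N - 1" | "i + 1 < N \<and> \<not> (e \<and> i + 2 = N)" | "\<exists>k. i = k + 1 \<and> \<not> (e \<and> k + 2 = N)"
  proof (cases "(e \<and> i = N - 1) \<or> (i + 1 < N \<and> \<not> (e \<and> i + 2 = N))")
    case False
    then obtain k where "i = k + 1" using assms(2,3) by (cases i) auto
    moreover have "\<not> (e \<and> k + 2 = N)" using False \<open>i = k + 1\<close> assms(2,3) by auto
    ultimately show ?thesis using that by blast
  qed (use that in blast)
  then show ?thesis using * e assms(3) by cases auto
qed

text \<open>After the elimination only the entries of row \<open>Suc p\<close> can lose positivity.
  Total nonnegativity leaves two outcomes, survival of the pattern or a row that is zero throughout;
  the latter is deleted, and the pattern reappears in the smaller matrix.\<close>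

lemma irreducible_tn_step:
  assumes irreducible_tn: "irreducible_tn e \<kappa> f N A" and ji: "j + 2 \<le> Suc p" "Suc p < N"
    and h1: "\<And>k j'. j' < j \<Longrightarrow> j' + 2 \<le> k \<Longrightarrow> k < N \<Longrightarrow> A k j' = 0"
    and h2: "\<And>k. Suc p < k \<Longrightarrow> k < N \<Longrightarrow> A k j = 0"
    and nz: "A (Suc p) j \<noteq> 0"
  defines "c \<equiv> A (Suc p) j / A p j"
  defines "B \<equiv> row_sub (Suc p) c A"
  defines "A' \<equiv> col_add (Suc p) c B"
  shows "0 < c" and "A (Suc p) j = c * A p j"
    and "irreducible_tn e \<kappa> f N A' \<or> (\<forall>k<N. A' (Suc p) k = 0)
      \<and> irreducible_tn e \<kappa> f (N - 1) (\<lambda>a b. A' (insert_index (Suc p) a) (insert_index (Suc p) b))"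
proof -
  have tn: "tn N A" and sub: "\<And>q. q + 1 < N \<Longrightarrow> 0 < A (q + 1) q"
    and sup: "\<And>q. q + 1 < N \<Longrightarrow> \<not> (e \<and> q + 2 = N) \<Longrightarrow> 0 < A q (q + 1)"
    and e: "e \<Longrightarrow> 0 < N \<and> 0 < \<kappa> \<and> A (N - 1) (N - 1) = \<kappa> \<and> (\<forall>q. q + 1 < N \<longrightarrow> A q (N - 1) = 0)"
    and f: "f \<Longrightarrow> q + 1 < q' \<Longrightarrow> q' < N \<Longrightarrow> A q q' = 0" for q q'
    using irreducible_tn unfolding irreducible_tn_def by auto
  have diag: "\<And>k. k < N \<Longrightarrow> 0 < A k k" using irreducible_tn_diag_pos[OF irreducible_tn] ji by auto
  have Aij: "0 < A (Suc p) j" using nz tn_entry[OF tn, of "Suc p" j] ji by simp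
  \<comment> \<open>If the pivot vanished, the minor with rows \<open>p\<close>,
    \<open>Suc p\<close> and columns \<open>j\<close>, \<open>p\<close> would be negative, the
    diagonal being positive.\<close>
  have piv: "0 < A p j"
  proof (rule ccontr)
    assume "\<not> 0 < A p j"
    then have z: "A p j = 0" using tn_entry[OF tn, of p j] ji by simp
    have "A p p * A (Suc p) j \<le> A p j * A (Suc p) p"
      using ji by (intro tn_2[OF tn]) auto
    moreover have "0 < A p p * A (Suc p) j" using diag[of p] Aij ji by simp
    ultimately show False using z by simp
  qed
  show c: "0 < c" unfolding c_def using Aij piv by simp
  show cA: "A (Suc p) j = c * A p j" unfolding c_def using piv by simp
  have "tn N (row_sub (Suc p) (A (Suc p) j / A (Suc p - 1) j) A)"
    using ji h1 h2 piv by (intro tn_neville[OF tn]) auto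
  then have tnB: "tn N B" unfolding B_def c_def by simp
  have tnA': "tn N A'" unfolding A'_def
    using ji c by (intro tn_col_add[OF tnB]) auto
  have B: "\<And>k l. k \<noteq> Suc p \<Longrightarrow> B k l = A k l" "\<And>l. B (Suc p) l = A (Suc p) l - c * A p l"
    unfolding B_def row_sub_def by auto
  have A': "\<And>k l. l \<noteq> p \<Longrightarrow> A' k l = B k l" "\<And>k. A' k p = B k p + c * B k (Suc p)"
    unfolding A'_def col_add_def by auto
  \<comment> \<open>The diagonal entry is included because the column operation adds
    \<open>c\<close> times it to \<open>B (Suc p) p\<close>, which the elimination may have reduced
    to 0; this restores a positive subdiagonal.\<close>
  let ?P = "0 < B (Suc p) (Suc p) \<and> (Suc p + 1 < N \<longrightarrow> \<not> (e \<and> Suc p + 2 = N) \<longrightarrow> 0 < B (Suc p) (Suc p + 1))"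
  let ?Z = "(\<forall>k<N. B (Suc p) k = 0) \<and> \<not> (e \<and> Suc p + 1 = N)"
  have "?P \<or> ?Z"
  proof -
    \<comment> \<open>In the corner row \<open>\<kappa>\<close> survives, since column
      \<open>N - 1\<close> has no other nonzero entry. In the second case a superdiagonal entry has
      to stay positive. In the third none is required in row \<open>Suc p\<close>, and the diagonal
      entry decides instead.\<close>
    consider "e \<and> Suc p + 1 = N" | "Suc p + 1 < N" "\<not> (e \<and> Suc p + 2 = N)"
      | "Suc p + 1 < N \<longrightarrow> e \<and> Suc p + 2 = N" "\<not> (e \<and> Suc p + 1 = N)" by blast
    then show ?thesis
    proof cases
      case 1
      then have "B (Suc p) (Suc p) = \<kappa>" using e by (auto simp: B)
      then show ?thesis using 1 e by auto
    next
      case 2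
      show ?thesis
      proof (cases "B (Suc p) (Suc p + 1) = 0")
        case False
        then have b: "0 < B (Suc p) (Suc p + 1)" using tn_entry[OF tnB, of "Suc p" "Suc p + 1"] 2 by simp
        have "0 < B (Suc p) (Suc p + 1) * B (Suc p + 1) (Suc p)" using b sub[of "Suc p"] 2 by (simp add: B)
        also have "\<dots> \<le> B (Suc p) (Suc p) * B (Suc p + 1) (Suc p + 1)" using 2 by (intro tn_2[OF tnB]) auto
        finally have "0 < B (Suc p) (Suc p)" using tn_entry[OF tnB, of "Suc p" "Suc p"] ji by (auto simp: zero_less_mult_iff)
        then show ?thesis using b by simp
      next
        case True
        \<comment> \<open>A positive entry that is cancelled completely forces a positive entry
          above it. The zero then spreads to the left by minors with rows \<open>p\<close>,
          \<open>Suc p\<close>, and to the right by minors with the next row, whose diagonal entry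
          is positive.\<close>
        have "0 < A (Suc p) (Suc p + 1)" using sup 2 by simp
        then have "0 < c * A p (Suc p + 1)" using True by (simp add: B)
        then have y: "0 < B p (Suc p + 1)" using c by (simp add: B zero_less_mult_iff)
        have "B (Suc p) k = 0" if k: "k < N" for k
        proof (cases "k < Suc p + 1")
          case True
          have "B p (Suc p + 1) * B (Suc p) k \<le> B p k * B (Suc p) (Suc p + 1)"
            using True 2 by (intro tn_2[OF tnB]) auto
          then have "B p (Suc p + 1) * B (Suc p) k \<le> 0" using \<open>B (Suc p) (Suc p + 1) = 0\<close> by simp
          then show ?thesis using y tn_entry[OF tnB, of "Suc p" k] k ji by (auto simp: mult_le_0_iff)
        next
          case False
          show ?thesis
          proof (cases "k = Suc p + 1")
            case ne: False
            have "B (Suc p) k * B (Suc p + 1) (Suc p + 1) \<le> B (Suc p) (Suc p + 1) * B (Suc p + 1) k"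
              using False ne k by (intro tn_2[OF tnB]) auto
            then have "B (Suc p) k * A (Suc p + 1) (Suc p + 1) \<le> 0" using \<open>B (Suc p) (Suc p + 1) = 0\<close> by (simp add: B)
            then show ?thesis
              using diag[of "Suc p + 1"] 2 tn_entry[OF tnB, of "Suc p" k] k ji by (auto simp: mult_le_0_iff)
          qed (use True in simp)
        qed
        then show ?thesis using 2 by auto
      qed
    next
      case 3
      show ?thesis
      proof (cases "B (Suc p) (Suc p) = 0")
        case False
        then have "0 < B (Suc p) (Suc p)" using tn_entry[OF tnB, of "Suc p" "Suc p"] ji by simp
        then show ?thesis using 3 by blast
      next
        case True
        have y: "0 < B p (Suc p)" using sup[of p] 3 ji by (auto simp: B)
        have "B (Suc p) k = 0" if k: "k < N" for k
        proof (cases "k < Suc p")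
          case True
          have "B p (Suc p) * B (Suc p) k \<le> B p k * B (Suc p) (Suc p)"
            using True ji by (intro tn_2[OF tnB]) auto
          then have "B p (Suc p) * B (Suc p) k \<le> 0" using \<open>B (Suc p) (Suc p) = 0\<close> by simp
          then show ?thesis using y tn_entry[OF tnB, of "Suc p" k] k ji by (auto simp: mult_le_0_iff)
        next
          case False
          show ?thesis
          proof (cases "k = Suc p")
            case ne: False
            then have k1: "k = N - 1" "e" "Suc p + 1 < N" using 3 False k by auto
            then have "A (Suc p) k = 0" "A p k = 0" using e by auto
            then show ?thesis by (simp add: B)
          qed (use True in simp)
        qed
        then show ?thesis using 3 by blast
      qed
    qed
  qed
  moreover have "irreducible_tn e \<kappa> f N A'" if P: ?P
    unfolding irreducible_tn_def
  proof (intro conjI impI allI)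
    fix k assume k: "k + 1 < N"
    show "0 < A' (k + 1) k"
    proof (cases "k = p")
      case True
      have "0 \<le> B (Suc p) p" "0 < c * B (Suc p) (Suc p)" using tn_entry[OF tnB, of "Suc p" p] ji P c by auto
      then show ?thesis using True by (simp add: A')
    next
      case False
      then show ?thesis using sub[OF k] by (simp add: A' B)
    qed
    assume ne: "\<not> (e \<and> k + 2 = N)"
    show "0 < A' k (k + 1)"
    proof (cases "k + 1 = p")
      case True
      have "0 < A k (k + 1)" "0 \<le> c * A k (Suc p)" using sup[OF k ne] c tn_entry[OF tn, of k "Suc p"] k ji by auto
      then show ?thesis using True by (simp add: A' B)
    next
      case False
      show ?thesis
      proof (cases "k = Suc p")
        case True
        then show ?thesis using P k ne by (simp add: A')
      next
        case False
        then show ?thesis using sup[OF k ne] \<open>k + 1 \<noteq> p\<close> by (simp add: A' B)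
      qed
    qed
  next
    assume e
    note e = e[OF this]
    show "0 < N" "0 < \<kappa>" using e by auto
    have "A p (N - 1) = 0" using e ji by auto
    then show "A' (N - 1) (N - 1) = \<kappa>" using e ji by (cases "N - 1 = (Suc p)") (auto simp: A' B)
    fix k assume "k + 1 < N"
    then have "A k (N - 1) = 0" using e by simp
    then show "A' k (N - 1) = 0" using \<open>A p (N - 1) = 0\<close> ji by (cases "k = Suc p") (auto simp: A' B)
  next
    fix k l assume f and kl: "k + 1 < l" "l < N"
    note f = f[OF \<open>f\<close>]
    have "B k l' = 0" if "k + 1 < l'" "l' < N" for l'
      using f[of k l'] f[of p l'] that by (cases "k = Suc p") (auto simp: B)
    then show "A' k l = 0" using kl ji by (cases "l = p") (auto simp: A')
  qed (rule tnA')
  \<comment> \<open>Deletion makes \<open>p\<close> and \<open>Suc p + 1\<close> neighbours. Their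
    new superdiagonal entry \<open>A p (Suc p + 1)\<close> is positive because \<open>c\<close>
    times it equals the cancelled entry; their new subdiagonal entry contains
    \<open>c * A (Suc p + 1) (Suc p)\<close>.\<close>
  moreover have "(\<forall>k<N. A' (Suc p) k = 0) \<and> irreducible_tn e \<kappa> f (N - 1) (\<lambda>a b. A' (insert_index (Suc p) a) (insert_index (Suc p) b))" if Z: ?Z
  proof
    show Z': "\<forall>k<N. A' (Suc p) k = 0" using Z A' ji by (metis add.right_neutral mult_zero_right)
    have ins: "insert_index (Suc p) ` {..<N - 1} \<subseteq> {..<N}" by (auto simp: insert_index_def)
    have A'1: "A' k l = A k l" if "k \<noteq> Suc p" "l \<noteq> p" for k l using that by (simp add: A' B)
    have A'2: "A' k p = A k p + c * A k (Suc p)" if "k \<noteq> Suc p" for k using that by (simp add: A' B)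
    show "irreducible_tn e \<kappa> f (N - 1) (\<lambda>a b. A' (insert_index (Suc p) a) (insert_index (Suc p) b))"
      unfolding irreducible_tn_def
    proof (intro conjI impI allI)
      show "tn (N - 1) (\<lambda>a b. A' (insert_index (Suc p) a) (insert_index (Suc p) b))"
        by (rule tn_compose[OF tnA' strict_mono_insert_index ins])
    next
      fix a assume a: "a + 1 < N - 1"
      consider "a + 1 < Suc p" | "a = p" | "Suc p \<le> a" by linarith
      then show "0 < A' (insert_index (Suc p) (a + 1)) (insert_index (Suc p) a)"
      proof cases
        case 1
        then show ?thesis using sub[of a] a by (simp add: A'1)
      next
        case 2
        have "0 \<le> A (Suc p + 1) p" "0 < c * A (Suc p + 1) (Suc p)"
          using tn_entry[OF tn, of "Suc p + 1" p] sub[of "Suc p"] a 2 c by auto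
        then show ?thesis using 2 by (simp add: A'2)
      next
        case 3
        then show ?thesis using sub[of "a + 1"] a by (simp add: A'1)
      qed
    next
      fix a assume a: "a + 1 < N - 1" and ne: "\<not> (e \<and> a + 2 = N - 1)"
      consider "a + 1 < Suc p" | "a = p" | "Suc p \<le> a" by linarith
      then show "0 < A' (insert_index (Suc p) a) (insert_index (Suc p) (a + 1))"
      proof cases
        case 1
        then have "0 < A a (a + 1)" using sup[of a] a ji by simp
        moreover have "0 \<le> c * A a (Suc p)" using c tn_entry[OF tn, of a "Suc p"] a ji by simp
        ultimately show ?thesis using 1 by (cases "a + 1 = p") (auto simp: A'1 A'2)
      next
        case 2
        have "Suc p + 1 < N" "\<not> (e \<and> Suc p + 2 = N)" using a ne 2 by auto
        then have "0 < A (Suc p) (Suc p + 1)" by (rule sup)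
        moreover have "B (Suc p) (Suc p + 1) = 0" using Z a 2 by auto
        ultimately have "0 < c * A p (Suc p + 1)" by (simp add: B)
        then show ?thesis using c 2 by (simp add: A'1 zero_less_mult_iff)
      next
        case 3
        have "a + 1 + 1 < N" "\<not> (e \<and> a + 1 + 2 = N)" using a ne by auto
        then have "0 < A (a + 1) (a + 1 + 1)" by (rule sup)
        then show ?thesis using 3 by (simp add: A'1)
      qed
    next
      assume e
      note e' = e[OF this]
      have iN: "Suc p + 1 < N" using Z ji \<open>e\<close> by auto
      show "0 < N - 1" "0 < \<kappa>" using iN e' by auto
      have ins: "insert_index (Suc p) (N - 1 - 1) = N - 1" using iN by (auto simp: insert_index_def)
      show "A' (insert_index (Suc p) (N - 1 - 1)) (insert_index (Suc p) (N - 1 - 1)) = \<kappa>"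
        unfolding ins using e' iN by (simp add: A'1)
      fix a assume a: "a + 1 < N - 1"
      then have "insert_index (Suc p) a + 1 < N" "insert_index (Suc p) a \<noteq> Suc p" by (auto simp: insert_index_def)
      then show "A' (insert_index (Suc p) a) (insert_index (Suc p) (N - 1 - 1)) = 0"
        unfolding ins using e' iN by (simp add: A'1)
    next
      fix a b assume f and ab: "a + 1 < b" "b < N - 1"
      note f = f[OF \<open>f\<close>]
      have *: "insert_index (Suc p) a + 1 < insert_index (Suc p) b" "insert_index (Suc p) b < N" "insert_index (Suc p) a \<noteq> Suc p"
        "insert_index (Suc p) b = p \<longrightarrow> insert_index (Suc p) a + 1 < Suc p"
        using ab by (auto simp: insert_index_def)
      show "A' (insert_index (Suc p) a) (insert_index (Suc p) b) = 0"
        using * f ji by (cases "insert_index (Suc p) b = p") (auto simp: A'1 A'2)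
    qed
  qed
  ultimately show "irreducible_tn e \<kappa> f N A' \<or> (\<forall>k<N. A' (Suc p) k = 0)
      \<and> irreducible_tn e \<kappa> f (N - 1) (\<lambda>a b. A' (insert_index (Suc p) a) (insert_index (Suc p) b))" by blast
qed

definition upper_hess :: "nat \<Rightarrow> (nat \<Rightarrow> nat \<Rightarrow> real) \<Rightarrow> bool" where
  "upper_hess N A \<longleftrightarrow> (\<forall>k j. j + 2 \<le> k \<longrightarrow> k < N \<longrightarrow> A k j = 0)"

text \<open>Columns to the left of \<open>j\<close> are finished and column \<open>j\<close> is
  cleared below row \<open>i\<close>. Clearing upwards from the bottom meets the zero conditions of
  \<open>tn_neville\<close>. Every step deletes a row, passes to the next column or moves up one
  row, which is the lexicographic measure.\<close>

lemma irreducible_tn_reduces_to_hess: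
  assumes "irreducible_tn e \<kappa> f N A"
    and "\<And>k j'. j' < j \<Longrightarrow> j' + 2 \<le> k \<Longrightarrow> k < N \<Longrightarrow> A k j' = 0"
    and "\<And>k. i < k \<Longrightarrow> k < N \<Longrightarrow> A k j = 0"
  shows "\<exists>N' A'. irreducible_tn e \<kappa> f N' A' \<and> upper_hess N' A' \<and> reduces_to N A N' A'"
  using assms
proof (induction "(N, N - j, i)" arbitrary: N A j i
    rule: wf_induct_rule[OF wf_lex_prod[OF wf_less_than wf_lex_prod[OF wf_less_than wf_less_than]], consumes 0, case_names less])
  case (less N j i A)
  note irreducible_tn = less.prems(1) and h1 = less.prems(2) and h2 = less.prems(3)
  consider "N \<le> j" | "j < N" "i < j + 2" | "j < N" "j + 2 \<le> i" "N \<le> i \<or> A i j = 0"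
    | "j + 2 \<le> i" "i < N" "A i j \<noteq> 0" by linarith
  then show ?case
  proof cases
    case 1
    then have "upper_hess N A" unfolding upper_hess_def using h1 by auto
    then show ?thesis using irreducible_tn reduces_to_refl by blast
  next
    case 2
    show ?thesis
    proof (rule less.hyps[of N "j + 1" N A])
      show "A k j' = 0" if "j' < j + 1" "j' + 2 \<le> k" "k < N" for k j'
        using that h1 h2[of k] 2 by (cases "j' = j") auto
    qed (use 2 irreducible_tn in auto)
  next
    case 3
    show ?thesis
    proof (rule less.hyps[of N j "i - 1" A])
      show "A k j = 0" if "i - 1 < k" "k < N" for k
        using that h2[of k] 3 by (cases "k = i") auto
      show "A k j' = 0" if "j' < j" "j' + 2 \<le> k" "k < N" for k j'
        using that by (rule h1)
    qed (use 3 irreducible_tn in auto)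
  next
    case 4
    then obtain p where p: "i = Suc p" by (cases i) auto
    define c where "c = A (Suc p) j / A p j"
    define A' where "A' = col_add (Suc p) c (row_sub (Suc p) c A)"
    note step = irreducible_tn_step[OF irreducible_tn 4(1,2)[unfolded p] h1 h2[unfolded p] 4(3)[unfolded p], folded c_def, folded A'_def, folded p]
    have r: "reduces_to N A N A'" unfolding A'_def using 4 p by (intro reduces_to_neville) auto
    \<comment> \<open>The column operation changes column \<open>i - 1\<close> only, and
      \<open>j + 2 \<le> i\<close> keeps it to the right of \<open>j\<close>, so the zeros already
      produced persist.\<close>
    have h1': "A' k j' = 0" if "j' < j" "j' + 2 \<le> k" "k < N" for k j'
      using that 4 h1[of j' k] h1[of j' p] p by (auto simp: A'_def col_add_def row_sub_def)
    have h2': "A' k j = 0" if "i - 1 < k" "k < N" for k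
      using that 4 h2[of k] step(2) p by (auto simp: A'_def col_add_def row_sub_def)
    from step(3) show ?thesis
    proof
      assume irreducible_tn': "irreducible_tn e \<kappa> f N A'"
      have "\<exists>N' A''. irreducible_tn e \<kappa> f N' A'' \<and> upper_hess N' A'' \<and> reduces_to N A' N' A''"
        by (rule less.hyps[of N j "i - 1" A', OF _ irreducible_tn' h1' h2']) (use 4 in auto)
      then show ?thesis using reduces_to_trans[OF r] by blast
    next
      let ?C = "\<lambda>a b. A' (insert_index i a) (insert_index i b)"
      assume *: "(\<forall>k<N. A' i k = 0) \<and> irreducible_tn e \<kappa> f (N - 1) ?C"
      have "reduces_to N A' (N - 1) ?C" using * 4 by (intro reduces_to_zero_row) auto
      with r have r': "reduces_to N A (N - 1) ?C" by (rule reduces_to_trans)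
      have "\<exists>N' A''. irreducible_tn e \<kappa> f N' A'' \<and> upper_hess N' A'' \<and> reduces_to (N - 1) ?C N' A''"
      proof (rule less.hyps[of "N - 1" j i ?C])
        show "?C k j' = 0" if "j' < j" "j' + 2 \<le> k" "k < N - 1" for k j'
          using that 4 h1'[of j' "insert_index i k"] by (auto simp: insert_index_def)
        show "?C k j = 0" if "i < k" "k < N - 1" for k
          using that 4 h2'[of "insert_index i k"] by (auto simp: insert_index_def)
      qed (use * 4 in auto)
      then show ?thesis using reduces_to_trans[OF r'] by blast
    qed
  qed
qed

section \<open>Tridiagonal matrices\<close>

lemma eigen_fun_combination:
  assumes "eigen_fun N A x v" "eigen_fun N A x w"
  shows "eigen_fun N A x (\<lambda>i. \<alpha> * v i + \<beta> * w i)"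
  unfolding eigen_fun_def
proof (intro allI impI)
  fix i assume i: "i < N"
  have "(\<Sum>j<N. A i j * (\<alpha> * v j + \<beta> * w j)) = \<alpha> * (\<Sum>j<N. A i j * v j) + \<beta> * (\<Sum>j<N. A i j * w j)"
    by (simp add: sum_distrib_left sum.distrib algebra_simps)
  also have "\<dots> = x * (\<alpha> * v i + \<beta> * w i)"
    using assms i unfolding eigen_fun_def by (simp add: algebra_simps)
  finally show "(\<Sum>j<N. A i j * (\<alpha> * v j + \<beta> * w j)) = x * (\<alpha> * v i + \<beta> * w i)" .
qed

text \<open>Row \<open>i + 1\<close> of the eigenvalue equation determines \<open>u i\<close> from
  later coordinates, the subdiagonal being nonzero; so zeros propagate downwards from the last
  index.\<close>

lemma hess_eigen_fun_zero:
  assumes hess: "upper_hess N A" and sub: "\<And>i. i + 1 < N \<Longrightarrow> 0 < A (i + 1) i"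
    and u: "eigen_fun N A x u" and last: "u (N - 1) = 0"
  shows "i < N \<Longrightarrow> u i = 0"
proof (induction "N - 1 - i" arbitrary: i rule: less_induct)
  case less
  show ?case
  proof (cases "i = N - 1")
    case False
    then have i: "i + 1 < N" using less.prems by simp
    have later: "u k = 0" if "i < k" "k < N" for k
      using that i by (intro less.hyps) auto
    have "(\<Sum>j<N. A (i + 1) j * u j) = (\<Sum>j\<in>{i}. A (i + 1) j * u j)"
    proof (rule sum.mono_neutral_right)
      show "\<forall>j\<in>{..<N} - {i}. A (i + 1) j * u j = 0"
      proof
        fix j assume j: "j \<in> {..<N} - {i}"
        show "A (i + 1) j * u j = 0"
          using hess later[of j] j i unfolding upper_hess_def by (cases "j < i") auto
      qed
    qed (use i in auto)
    moreover have "(\<Sum>j<N. A (i + 1) j * u j) = 0"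
      using u i later[of "i + 1"] unfolding eigen_fun_def by simp
    ultimately show ?thesis using sub[OF i] by simp
  qed (use last in simp)
qed

text \<open>The last coordinate determines an eigenvector, so a combination of two in which it
  cancels is zero.\<close>

lemma thin_eigenspaces_hess:
  assumes hess: "upper_hess N A" and sub: "\<And>i. i + 1 < N \<Longrightarrow> 0 < A (i + 1) i"
  shows "thin_eigenspaces N A"
  unfolding thin_eigenspaces_def
proof (intro allI impI)
  fix x v w assume v: "eigen_fun N A x v" and w: "eigen_fun N A x w"
  show "\<exists>\<alpha> \<beta>. (\<alpha> \<noteq> 0 \<or> \<beta> \<noteq> 0) \<and> (\<forall>i<N. \<alpha> * v i + \<beta> * w i = 0)"
  proof (cases "v (N - 1) = 0")
    case True
    then have "\<forall>i<N. 1 * v i + 0 * w i = 0"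
      using hess_eigen_fun_zero[OF hess sub v] by auto
    then show ?thesis by (intro exI[of _ 1] exI[of _ 0]) auto
  next
    case False
    have "\<forall>i<N. w (N - 1) * v i + (- v (N - 1)) * w i = 0"
      using hess_eigen_fun_zero[OF hess sub eigen_fun_combination[OF v w, of "w (N - 1)" "- v (N - 1)"]] by auto
    then show ?thesis using False by (intro exI[of _ "w (N - 1)"] exI[of _ "- v (N - 1)"]) auto
  qed
qed

lemma remove_nth_last_upt: "remove_nth k [0..<Suc k] = [0..<k]"
  by (simp add: remove_nth_def)

lemma char_poly_last_col:
  assumes N: "0 < N" and z: "\<And>i. i + 1 < N \<Longrightarrow> A i (N - 1) = 0"
  shows "char_poly (fmat N A) = [:- A (N - 1) (N - 1), 1:] * char_poly (fmat (N - 1) A)"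
proof -
  obtain k where k: "N = Suc k" using N by (cases N) auto
  have "char_poly (fmat N A) = (\<Sum>a<Suc k. (-1)^(a+k) * char_fun A a k
      * minor (char_fun A) (remove_nth a [0..<Suc k]) (remove_nth k [0..<Suc k]))"
    unfolding char_poly_fmat k
    by (subst minor_laplace_col[of k]) (auto simp del: upt_Suc sum.lessThan_Suc intro!: sum.cong)
  also have "\<dots> = (\<Sum>a\<in>{k}. (-1)^(a+k) * char_fun A a k
      * minor (char_fun A) (remove_nth a [0..<Suc k]) (remove_nth k [0..<Suc k]))"
    using z k by (intro sum.mono_neutral_right) (auto simp: char_fun_def)
  also have "\<dots> = [:- A k k, 1:] * char_poly (fmat k A)"
    by (simp add: remove_nth_last_upt char_fun_def char_poly_fmat power_add[symmetric] mult_2[symmetric] del: upt_Suc)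
  finally show ?thesis by (simp add: k)
qed

text \<open>The recurrence of continuants, in a general ring because it serves both for
  \<open>T\<close>, whose minors are nonnegative, and for \<open>x I - T\<close>.\<close>

lemma minor_tridiagonal:
  assumes "\<And>i j. i + 1 < j \<Longrightarrow> j < k + 2 \<Longrightarrow> A i j = 0" "\<And>i j. j + 1 < i \<Longrightarrow> i < k + 2 \<Longrightarrow> A i j = 0"
  shows "minor A [0..<k + 2] [0..<k + 2] = A (k + 1) (k + 1) * minor A [0..<k + 1] [0..<k + 1]
      - A k (k + 1) * A (k + 1) k * minor A [0..<k] [0..<k]"
proof -
  let ?J = "[0..<k] @ [k + 1]"
  have upt: "[0..<k + 2] = [0..<k] @ [k, k + 1]" "[0..<k + 1] = [0..<k] @ [k]" by auto
  have dk: "remove_nth k [0..<k + 2] = ?J" "remove_nth (Suc k) [0..<k + 2] = [0..<Suc k]"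
    unfolding upt by (auto simp: remove_nth_def)
  have "minor A [0..<k + 2] [0..<k + 2] = (\<Sum>b<k + 2. (-1)^(k + 1 + b) * A (k + 1) b
      * minor A (remove_nth (k + 1) [0..<k + 2]) (remove_nth b [0..<k + 2]))"
    by (subst minor_laplace_row[of "k + 1"]) (auto simp del: upt_Suc sum.lessThan_Suc intro!: sum.cong)
  also have "\<dots> = (\<Sum>b\<in>{k, k + 1}. (-1)^(k + 1 + b) * A (k + 1) b
      * minor A (remove_nth (k + 1) [0..<k + 2]) (remove_nth b [0..<k + 2]))"
    using assms(2) by (intro sum.mono_neutral_right) auto
  also have "\<dots> = A (k + 1) (k + 1) * minor A [0..<k + 1] [0..<k + 1]
      - A (k + 1) k * minor A [0..<k + 1] ?J"
    by (simp add: dk power_add[symmetric] mult_2[symmetric] del: upt_Suc add_2_eq_Suc')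
  also have "minor A [0..<k + 1] ?J = (\<Sum>a<k + 1. (-1)^(a + k) * A a (k + 1)
      * minor A (remove_nth a [0..<k + 1]) (remove_nth k ?J))"
    by (subst minor_laplace_col[of k]) (auto simp: nth_append simp del: upt_Suc sum.lessThan_Suc intro!: sum.cong)
  also have "\<dots> = (\<Sum>a\<in>{k}. (-1)^(a + k) * A a (k + 1)
      * minor A (remove_nth a [0..<k + 1]) (remove_nth k ?J))"
    using assms(1) by (intro sum.mono_neutral_right) auto
  also have "\<dots> = A k (k + 1) * minor A [0..<k] [0..<k]"
    by (simp add: remove_nth_def power_add[symmetric] mult_2[symmetric])
  finally show ?thesis by (simp add: algebra_simps)
qed

lemma minor_char_fun_tridiagonal:
  assumes "\<And>i j. i + 1 < j \<Longrightarrow> j < k + 2 \<Longrightarrow> A i j = 0" "\<And>i j. j + 1 < i \<Longrightarrow> i < k + 2 \<Longrightarrow> A i j = 0"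
  shows "char_poly (fmat (k + 2) A) = [:- A (k + 1) (k + 1), 1:] * char_poly (fmat (k + 1) A)
      - Polynomial.smult (A k (k + 1) * A (k + 1) k) (char_poly (fmat k A))"
  unfolding char_poly_fmat using assms
  by (subst minor_tridiagonal) (auto simp: char_fun_def mult.commute)

section \<open>Zeros of polynomials with a three-term recurrence\<close>

interpretation cr: map_poly_inj_idom_hom complex_of_real ..

text \<open>Models the characteristic polynomials of the leading blocks of a Jacobi matrix.
  Off-diagonal entries enter only through the products \<open>b k\<close>, so the matrix need not be
  symmetrised.\<close>

locale three_term =
  fixes M :: nat and a b :: "nat \<Rightarrow> real" and \<phi> :: "nat \<Rightarrow> real poly"
  assumes \<phi>0: "\<phi> 0 = 1" and \<phi>1: "0 < M \<Longrightarrow> \<phi> 1 = [:- a 0, 1:]"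
    and rec: "k + 2 \<le> M \<Longrightarrow> \<phi> (k + 2) = [:- a (k + 1), 1:] * \<phi> (k + 1) - Polynomial.smult (b k) (\<phi> k)"
    and b: "k + 2 \<le> M \<Longrightarrow> 0 < b k"
begin

text \<open>For nonreal \<open>z\<close> the imaginary part of \<open>P (k + 1) * cnj (P k)\<close>
  keeps the sign of \<open>Im z\<close>: the recurrence contributes \<open>Im z\<close> times a
  square plus \<open>b k\<close> times the previous imaginary part. Hence no
  \<open>P (k + 1)\<close> vanishes.\<close>

lemma complex_root_real:
  assumes "poly (map_poly complex_of_real (\<phi> M)) z = 0"
  shows "Im z = 0"
proof (rule ccontr)
  assume z: "Im z \<noteq> 0"
  define P where "P k = poly (map_poly complex_of_real (\<phi> k)) z" for k
  have P0: "P 0 = 1" by (simp add: P_def \<phi>0)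
  have P1: "P 1 = z - a 0" if "0 < M" using that by (simp add: P_def \<phi>1[unfolded One_nat_def] map_poly_pCons)
  have Prec: "P (k + 2) = (z - a (k + 1)) * P (k + 1) - b k * P k" if "k + 2 \<le> M" for k
    unfolding P_def rec[OF that]
    by (simp only: cr.hom_minus cr.hom_mult of_real_hom.map_poly_hom_smult)
      (simp add: map_poly_pCons algebra_simps)
  have V: "0 < Im (P (k + 1) * cnj (P k)) * Im z" if "k + 1 \<le> M" for k
    using that
  proof (induction k)
    case 0
    then show ?case using z by (auto simp: P0 P1[unfolded One_nat_def] zero_less_mult_iff linorder_neq_iff)
  next
    case (Suc k)
    have "P (k + 2) * cnj (P (k + 1)) = (z - a (k + 1)) * (P (k + 1) * cnj (P (k + 1))) - b k * (P k * cnj (P (k + 1)))"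
      using Suc.prems by (subst Prec) (auto simp: algebra_simps)
    also have "P (k + 1) * cnj (P (k + 1)) = complex_of_real ((cmod (P (k + 1)))\<^sup>2)"
      by (metis complex_norm_square)
    finally have "Im (P (k + 2) * cnj (P (k + 1)))
        = Im z * (cmod (P (k + 1)))\<^sup>2 - b k * Im (P k * cnj (P (k + 1)))" by simp
    also have "Im (P k * cnj (P (k + 1))) = - Im (P (k + 1) * cnj (P k))"
      by (simp add: algebra_simps)
    finally have X: "Im (P (k + 2) * cnj (P (k + 1)))
        = Im z * (cmod (P (k + 1)))\<^sup>2 - b k * - Im (P (k + 1) * cnj (P k))" .
    have "Im (P (k + 2) * cnj (P (k + 1))) * Im z
        = (Im z)\<^sup>2 * (cmod (P (k + 1)))\<^sup>2 + b k * (Im (P (k + 1) * cnj (P k)) * Im z)"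
      unfolding X by (simp only: power2_eq_square distrib_left mult_minus_right mult_minus_left diff_minus_eq_add mult_ac)
    moreover have "0 < b k * (Im (P (k + 1) * cnj (P k)) * Im z)"
      using Suc.prems by (intro mult_pos_pos[OF b Suc.IH]) auto
    ultimately show ?case by (simp add: add_nonneg_pos del: times_complex.sel complex_cnj_mult)
  qed
  have "P M \<noteq> 0"
  proof (cases M)
    case (Suc k)
    then show ?thesis using V[of k] by auto
  qed (simp add: P0)
  then show False using assms by (simp add: P_def)
qed

text \<open>The Christoffel--Darboux identity makes the Wronskian of consecutive terms positive.\<close>

lemma real_root_simple:
  assumes "poly (\<phi> M) x = 0"
  shows "poly (pderiv (\<phi> M)) x \<noteq> 0"
proof -
  define W where "W k = poly (pderiv (\<phi> (k + 1))) x * poly (\<phi> k) x - poly (\<phi> (k + 1)) x * poly (pderiv (\<phi> k)) x" for k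
  have W: "0 < W k" if "k + 1 \<le> M" for k
    using that
  proof (induction k)
    case 0
    then show ?case using \<phi>0 \<phi>1 by (simp add: W_def pderiv_pCons)
  next
    case (Suc k)
    have pd: "pderiv (\<phi> (k + 2)) = \<phi> (k + 1) + [:- a (k + 1), 1:] * pderiv (\<phi> (k + 1)) - Polynomial.smult (b k) (pderiv (\<phi> k))"
    proof -
      have "pderiv (\<phi> (k + 2)) = pderiv ([:- a (k + 1), 1:] * \<phi> (k + 1)) - pderiv (Polynomial.smult (b k) (\<phi> k))"
        using rec[of k] Suc.prems by (simp only: pderiv_diff)
      also have "pderiv ([:- a (k + 1), 1:] * \<phi> (k + 1)) = [:- a (k + 1), 1:] * pderiv (\<phi> (k + 1)) + \<phi> (k + 1)"
        by (simp only: pderiv_mult) (simp add: pderiv_pCons)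
      finally show ?thesis by (simp add: pderiv_smult)
    qed
    have "W (Suc k) = poly (pderiv (\<phi> (k + 2))) x * poly (\<phi> (k + 1)) x - poly (\<phi> (k + 2)) x * poly (pderiv (\<phi> (k + 1))) x"
      by (simp add: W_def)
    also have "\<dots> = (poly (\<phi> (k + 1)) x)\<^sup>2 + b k * W k"
      unfolding pd using Suc.prems by (subst rec) (auto simp: W_def algebra_simps power2_eq_square)
    also have "\<dots> > 0" using Suc b[of k] by (intro add_nonneg_pos mult_pos_pos) auto
    finally show ?case .
  qed
  show ?thesis
  proof (cases M)
    case 0
    then show ?thesis using assms \<phi>0 by simp
  next
    case (Suc k)
    then show ?thesis using W[of k] assms by (auto simp: W_def)
  qed
qed

lemma order_le_1: "Polynomial.order x (\<phi> M) \<le> 1"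
proof (rule ccontr)
  assume "\<not> Polynomial.order x (\<phi> M) \<le> 1"
  then have "2 \<le> Polynomial.order x (\<phi> M)" by simp
  then have "[:- x, 1:] ^ 2 dvd \<phi> M" by (rule power_le_dvd[OF order_1])
  then obtain q where q: "\<phi> M = [:- x, 1:] ^ 2 * q" by (elim dvdE)
  define r where "r = [:- x, 1:] * q"
  have \<phi>: "\<phi> M = [:- x, 1:] * r" unfolding r_def q by (simp only: power2_eq_square mult.assoc)
  have "poly r x = 0" by (simp add: r_def)
  then have "poly (\<phi> M) x = 0" "poly (pderiv (\<phi> M)) x = 0"
    unfolding \<phi> pderiv_mult by (simp_all add: pderiv_pCons)
  then show False using real_root_simple by blast
qed

text \<open>\<open>D k\<close> plays the role of the leading principal minors, i.e. of \<open>(-1)\<^sup>k \<phi> k\<close> at \<open>0\<close>.\<close>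

lemma neg_not_root:
  assumes D0: "D 0 = 1" and D1: "0 < M \<Longrightarrow> D 1 = a 0"
    and D: "\<And>k. k + 2 \<le> M \<Longrightarrow> D (k + 2) = a (k + 1) * D (k + 1) - b k * D k"
    and nn: "\<And>k. k \<le> M \<Longrightarrow> 0 \<le> D k" and x: "x < 0"
  shows "poly (\<phi> M) x \<noteq> 0"
proof -
  \<comment> \<open>A zero of \<open>D\<close> before index \<open>M\<close> would make the next but
    one value \<open>- b k * D k\<close>, which is negative.\<close>
  have Dpos: "0 < D k" if "k < M" for k
    using that
  proof (induction k)
    case 0
    then show ?case by (simp add: D0)
  next
    case (Suc k)
    show ?case
    proof (rule ccontr)
      assume "\<not> 0 < D (Suc k)"
      then have "D (Suc k) = 0" using nn[of "Suc k"] Suc.prems by simp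
      then have "D (k + 2) = - (b k * D k)" using D[of k] Suc.prems by simp
      moreover have "0 < b k * D k" using Suc b[of k] by simp
      ultimately show False using nn[of "k + 2"] Suc.prems by simp
    qed
  qed
  define Q where "Q k = (-1)^k * poly (\<phi> k) x" for k
  have Q0: "Q 0 = 1" by (simp add: Q_def \<phi>0)
  have Q1: "Q 1 = a 0 - x" if "0 < M" using that by (simp add: Q_def \<phi>1[unfolded One_nat_def])
  have Qrec: "Q (k + 2) = (a (k + 1) - x) * Q (k + 1) - b k * Q k" if "k + 2 \<le> M" for k
    unfolding Q_def rec[OF that] by (simp add: algebra_simps)
  \<comment> \<open>Read as a comparison of the ratios \<open>Q (k + 1) / Q k\<close> and
    \<open>D (k + 1) / D k\<close>: passing from 0 to a negative \<open>x\<close> increases every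
    ratio. The products avoid dividing by \<open>D\<close>, whose last value may be 0.\<close>
  have *: "0 < Q k \<and> D (k + 1) * Q k < Q (k + 1) * D k" if "k + 1 \<le> M" for k
    using that
  proof (induction k)
    case 0
    then show ?case using x Q1 D1 by (simp add: Q0 D0)
  next
    case (Suc k)
    have k: "k + 2 \<le> M" using Suc.prems by simp
    have IH: "0 < Q k" "D (k + 1) * Q k < Q (k + 1) * D k" using Suc by auto
    have "0 \<le> D (k + 1) * Q k" using IH nn[of "k + 1"] k by simp
    then have "0 < Q (k + 1) * D k" using IH by simp
    then have Qp: "0 < Q (k + 1)" using Dpos[of k] k by (simp add: zero_less_mult_iff)
    have "Q (k + 2) * D (k + 1) - D (k + 2) * Q (k + 1)
        = (- x) * (Q (k + 1) * D (k + 1)) + b k * (Q (k + 1) * D k - D (k + 1) * Q k)"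
      unfolding Qrec[OF k] D[OF k] by (simp add: algebra_simps)
    also have "\<dots> > 0"
      using x Qp IH b[OF k] Dpos[of "k + 1"] k by (intro add_pos_pos mult_pos_pos) auto
    finally show ?case using Qp by simp
  qed
  have "Q M \<noteq> 0"
  proof (cases M)
    case (Suc k)
    have "0 \<le> D (k + 1) * Q k" using *[of k] Suc nn[of "k + 1"] by simp
    then have "0 < Q (k + 1) * D k" using *[of k] Suc by simp
    then show ?thesis using Suc by auto
  qed (simp add: Q0)
  then show ?thesis by (simp add: Q_def)
qed

end

lemma irreducible_tn_spectrum:
  assumes "irreducible_tn True \<kappa> False N A"
  shows "thin_eigenspaces N A \<and> (\<exists>d q. char_poly (fmat N A) = [:0, 1:] ^ d * [:- \<kappa>, 1:] * q
     \<and> (\<forall>z. poly (map_poly complex_of_real q) z = 0 \<longrightarrow> Im z = 0)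
     \<and> (\<forall>x. Polynomial.order x q \<le> 1) \<and> (\<forall>x<0. poly q x \<noteq> 0))"
proof -
  obtain N1 B where B: "irreducible_tn True \<kappa> False N1 B" "upper_hess N1 B" "reduces_to N A N1 B"
    using irreducible_tn_reduces_to_hess[OF assms, of 0 N] by auto
  have tnB: "tn N1 B" and sub: "\<And>i. i + 1 < N1 \<Longrightarrow> 0 < B (i + 1) i"
    and sup: "\<And>i. i + 1 < N1 \<Longrightarrow> i + 2 \<noteq> N1 \<Longrightarrow> 0 < B i (i + 1)"
    and corner: "0 < N1" "B (N1 - 1) (N1 - 1) = \<kappa>" "\<And>i. i + 1 < N1 \<Longrightarrow> B i (N1 - 1) = 0"
    using B(1) unfolding irreducible_tn_def by auto
  define C where "C = (\<lambda>i j. B j i)"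
  have tnC: "tn (N1 - 1) C"
    using tn_compose[OF tn_transpose[OF tnB], of "N1 - 1" "\<lambda>i. i"] unfolding C_def
    by (auto simp: strict_mono_on_def)
  have "irreducible_tn False \<kappa> True (N1 - 1) C"
    using tnC sub sup B(2) unfolding irreducible_tn_def C_def upper_hess_def by auto
  from irreducible_tn_reduces_to_hess[OF this, of 0 "N1 - 1"] obtain M T
    where T: "irreducible_tn False \<kappa> True M T" "upper_hess M T" "reduces_to (N1 - 1) C M T"
    by auto
  have tnT: "tn M T" and offd: "\<And>i. i + 1 < M \<Longrightarrow> 0 < T i (i + 1) * T (i + 1) i"
    and low: "\<And>i j. i + 1 < j \<Longrightarrow> j < M \<Longrightarrow> T i j = 0"
    using T(1) unfolding irreducible_tn_def by auto
  have up: "\<And>i j. j + 1 < i \<Longrightarrow> i < M \<Longrightarrow> T i j = 0"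
    using T(2) unfolding upper_hess_def by simp
  interpret three_term M "\<lambda>k. T k k" "\<lambda>k. T k (k + 1) * T (k + 1) k" "\<lambda>k. char_poly (fmat k T)"
  proof
    show "char_poly (fmat 0 T) = 1" by (simp add: char_poly_fmat)
    show "char_poly (fmat 1 T) = [:- T 0 0, 1:]" by (simp add: char_poly_fmat char_fun_def)
    show "char_poly (fmat (k + 2) T) = [:- T (k + 1) (k + 1), 1:] * char_poly (fmat (k + 1) T)
        - Polynomial.smult (T k (k + 1) * T (k + 1) k) (char_poly (fmat k T))" if "k + 2 \<le> M" for k
      by (rule minor_char_fun_tridiagonal) (use that low up in auto)
  qed (use offd in auto)
  have neg: "poly (char_poly (fmat M T)) x \<noteq> 0" if "x < 0" for x
  proof (rule neg_not_root[of "\<lambda>k. minor T [0..<k] [0..<k]", OF _ _ _ _ that])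
    show "minor T [0..<k + 2] [0..<k + 2] = T (k + 1) (k + 1) * minor T [0..<k + 1] [0..<k + 1]
        - T k (k + 1) * T (k + 1) k * minor T [0..<k] [0..<k]" if "k + 2 \<le> M" for k
      by (rule minor_tridiagonal) (use that low up in auto)
    show "0 \<le> minor T [0..<k] [0..<k]" if "k \<le> M" for k
      using that by (intro tnD[OF tnT]) auto
  qed auto
  obtain d1 d2 where d: "char_poly (fmat N A) = [:0, 1:] ^ d1 * char_poly (fmat N1 B)"
    "char_poly (fmat (N1 - 1) C) = [:0, 1:] ^ d2 * char_poly (fmat M T)"
    using B(3) T(3) unfolding reduces_to_def by blast
  have "char_poly (fmat N1 B) = [:- \<kappa>, 1:] * char_poly (fmat (N1 - 1) C)"
    using char_poly_last_col[of N1 B] corner char_poly_fmat_transpose[of "N1 - 1" B] unfolding C_def by simp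
  then have "char_poly (fmat N A) = [:0, 1:] ^ (d1 + d2) * [:- \<kappa>, 1:] * char_poly (fmat M T)"
    unfolding d by (simp only: power_add mult_ac)
  moreover have "thin_eigenspaces N A"
    using B(3) thin_eigenspaces_hess[OF B(2) sub] unfolding reduces_to_def by blast
  ultimately show ?thesis
    using complex_root_real order_le_1 neg by blast
qed

section \<open>Principal minors and the multiplicity of the eigenvalue zero\<close>

lemma minor_const_poly:
  fixes A :: "nat \<Rightarrow> nat \<Rightarrow> 'a::comm_ring_1"
  assumes "length is = length js"
  shows "minor (\<lambda>i j. [:- A i j:]) is js = [:(-1) ^ length is * minor A is js:]"
  using assms
proof (induction "length is" arbitrary: "is" js)
  case (Suc n)
  have sum_const: "(\<Sum>b<k. [:f b:]) = [:\<Sum>b<k. f b:]" for k and f :: "nat \<Rightarrow> 'a"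
    by (induction k) auto
  have 0: "0 < length is" using Suc.hyps(2) by linarith
  have "minor (\<lambda>i j. [:- A i j:]) is js
      = (\<Sum>b<length is. (-1)^b * [:- A (is ! 0) (js ! b):] * minor (\<lambda>i j. [:- A i j:]) (remove_nth 0 is) (remove_nth b js))"
    using Suc.prems 0 by (subst minor_laplace_row[OF 0]) auto
  also have "\<dots> = (\<Sum>b<length is. [:(-1)^b * - A (is ! 0) (js ! b) * ((-1) ^ n * minor A (remove_nth 0 is) (remove_nth b js)):])"
  proof (rule sum.cong[OF refl])
    fix b assume b: "b \<in> {..<length is}"
    have IH: "minor (\<lambda>i j. [:- A i j:]) (remove_nth 0 is) (remove_nth b js) = [:(-1) ^ n * minor A (remove_nth 0 is) (remove_nth b js):]"
    proof -
      have "n = length (remove_nth 0 is)" "length (remove_nth 0 is) = length (remove_nth b js)"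
        using Suc.hyps(2)[symmetric] Suc.prems b 0 by auto
      then show ?thesis using Suc.hyps(1)[of "remove_nth 0 is" "remove_nth b js"] by simp
    qed
    show "(-1)^b * [:- A (is ! 0) (js ! b):] * minor (\<lambda>i j. [:- A i j:]) (remove_nth 0 is) (remove_nth b js)
      = [:(-1)^b * - A (is ! 0) (js ! b) * ((-1) ^ n * minor A (remove_nth 0 is) (remove_nth b js)):]"
      unfolding IH by (cases "even b") auto
  qed
  also have "\<dots> = [:(-1) ^ length is * minor A is js:]"
  proof -
    have "(-1) ^ length is * minor A is js
        = (\<Sum>b<length is. (-1) ^ length is * ((-1)^(0 + b) * A (is ! 0) (js ! b) * minor A (remove_nth 0 is) (remove_nth b js)))"
      using minor_laplace_row[OF 0, of js A] Suc.prems by (simp only: sum_distrib_left)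
    also have "\<dots> = (\<Sum>b<length is. (-1)^b * - A (is ! 0) (js ! b) * ((-1) ^ n * minor A (remove_nth 0 is) (remove_nth b js)))"
      unfolding Suc.hyps(2)[symmetric] by (intro sum.cong) (auto simp: mult_ac)
    finally show ?thesis unfolding sum_const by simp
  qed
  finally show ?case .
qed (simp add: one_pCons)

text \<open>Interpolates between the constant matrix \<open>-A\<close> (\<open>S\<close> empty) and
  \<open>x I - A\<close>, so that the variable can be introduced one diagonal position at a
  time.\<close>

definition part_char :: "(nat \<Rightarrow> nat \<Rightarrow> real) \<Rightarrow> nat set \<Rightarrow> nat \<Rightarrow> nat \<Rightarrow> real poly" where
  "part_char A S i j = (if i = j \<and> i \<in> S then [:- A i j, 1:] else [:- A i j:])"

lemma minor_part_char_split:
  assumes "L = T @ k # U" "distinct L" "k \<in> S"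
  shows "minor (part_char A S) L L = minor (part_char A (S - {k})) L L
     + [:0, 1:] * minor (part_char A (S - {k})) (T @ U) (T @ U)"
proof -
  let ?B = "part_char A S" and ?B' = "part_char A (S - {k})"
  have eq: "minor ?B (T @ U) js = minor ?B' (T @ U) js" if "length js = length (T @ U)" for js
  proof (rule minor_cong)
    fix a b assume "a < length (T @ U)"
    then have "(T @ U) ! a \<noteq> k" using assms(1,2) nth_mem[of a "T @ U"] by auto
    then show "?B ((T @ U) ! a) (js ! b) = ?B' ((T @ U) ! a) (js ! b)"
      by (simp add: part_char_def)
  qed simp
  have len: "length L = length T + length U + 1" using assms by simp
  have "minor ?B L L = (\<Sum>b<length L. (-1)^(length T + b) * ?B k (L ! b) * minor ?B' (T @ U) (remove_nth b L))"
    using minor_expand_middle[OF len, of ?B k] len unfolding assms(1)[symmetric]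
    by (auto simp: eq intro!: sum.cong simp del: sum.lessThan_Suc)
  also have "\<dots> = (\<Sum>b<length L. (-1)^(length T + b) * ?B' k (L ! b) * minor ?B' (T @ U) (remove_nth b L)
      + (if b = length T then [:0, 1:] * minor ?B' (T @ U) (T @ U) else 0))"
  proof (rule sum.cong[OF refl])
    fix b assume b: "b \<in> {..<length L}"
    show "(-1)^(length T + b) * ?B k (L ! b) * minor ?B' (T @ U) (remove_nth b L)
      = (-1)^(length T + b) * ?B' k (L ! b) * minor ?B' (T @ U) (remove_nth b L)
      + (if b = length T then [:0, 1:] * minor ?B' (T @ U) (T @ U) else 0)"
    proof (cases "b = length T")
      case True
      have B: "?B k k = ?B' k k + [:0, 1:]" using assms(3) by (simp add: part_char_def)
      have L: "L ! b = k" "remove_nth b L = T @ U" using True by (auto simp: assms(1) remove_nth_middle)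
      show ?thesis
        unfolding L B using True by (simp only: power_add[symmetric] mult_2[symmetric])
          (simp add: algebra_simps)
    next
      case False
      then have "L ! b \<noteq> k"
        using assms(1,2) b nth_eq_iff_index_eq[of L b "length T"] by auto
      then have "?B k (L ! b) = ?B' k (L ! b)" by (simp add: part_char_def)
      then show ?thesis using False by simp
    qed
  qed
  also have "\<dots> = minor ?B' L L + [:0, 1:] * minor ?B' (T @ U) (T @ U)"
    using minor_expand_middle[OF len, of ?B' k] len unfolding assms(1)[symmetric]
    by (simp add: sum.distrib del: sum.lessThan_Suc)
  finally show ?thesis .
qed

text \<open>Up to sign each coefficient is a sum of principal minors. As these are nonnegative
  nothing cancels, and every single one is a lower bound for the absolute value. Induction on
  \<open>card S\<close> gives the sign and the bound together, without writing out the sum.\<close>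

lemma coeff_minor_part_char:
  assumes "finite S" "sorted_wrt (<) L"
    and P0: "\<And>K. sorted_wrt (<) K \<Longrightarrow> set K \<subseteq> set L \<Longrightarrow> 0 \<le> minor A K K"
  shows "0 \<le> (-1)^(length L + k) * coeff (minor (part_char A S) L L) k
    \<and> (\<forall>K. sorted_wrt (<) K \<longrightarrow> set K \<subseteq> set L \<longrightarrow> set L - set K \<subseteq> S \<longrightarrow>
          minor A K K \<le> (-1)^length K * coeff (minor (part_char A S) L L) (length L - length K))"
  using assms
proof (induction "card S" arbitrary: S L k)
  case (0 S L k)
  have eq: "minor (part_char A S) L L = [:(-1) ^ length L * minor A L L:]"
    using 0 by (subst minor_const_poly[symmetric]) (auto simp: part_char_def intro!: minor_cong)
  have nn: "0 \<le> minor A L L" using 0 by simp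
  have "0 \<le> (-1)^(length L + k) * coeff (minor (part_char A S) L L) k"
    using nn unfolding eq by (cases k) (auto simp: mult.assoc[symmetric] power_add[symmetric] mult_2[symmetric])
  moreover have "minor A K K \<le> (-1)^length K * coeff (minor (part_char A S) L L) (length L - length K)"
    if "sorted_wrt (<) K" "set K \<subseteq> set L" "set L - set K \<subseteq> S" for K
  proof -
    have "set K = set L" using that 0 by auto
    then have "K = L" using that 0 by (metis strict_sorted_equal)
    then show ?thesis unfolding eq
      by (simp add: mult.assoc[symmetric] power_add[symmetric] mult_2[symmetric])
  qed
  ultimately show ?case by blast
next
  case (Suc n S L k)
  obtain q where q: "q \<in> S" using Suc.hyps(2) by fastforce
  have S': "n = card (S - {q})" "finite (S - {q})" using Suc.hyps(2) Suc.prems(1) q by auto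
  note IH1 = Suc.hyps(1)[OF S' Suc.prems(2,3)]
  show ?case
  proof (cases "q \<in> set L")
    case False
    have "minor (part_char A S) L L = minor (part_char A (S - {q})) L L"
      using False by (intro minor_cong) (auto simp: part_char_def)
    then show ?thesis using IH1[of k] IH1[of 0] False by auto
  next
    case True
    then obtain T U where L: "L = T @ q # U" by (meson split_list)
    have d: "distinct L" using Suc.prems(2) strict_sorted_iff by blast
    have sTU: "sorted_wrt (<) (T @ U)" using Suc.prems(2) unfolding L by (auto simp: sorted_wrt_append)
    have IH2: "0 \<le> (-1)^(length (T @ U) + k) * coeff (minor (part_char A (S - {q})) (T @ U) (T @ U)) k
      \<and> (\<forall>K. sorted_wrt (<) K \<longrightarrow> set K \<subseteq> set (T @ U) \<longrightarrow> set (T @ U) - set K \<subseteq> S - {q} \<longrightarrow>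
          minor A K K \<le> (-1)^length K * coeff (minor (part_char A (S - {q})) (T @ U) (T @ U)) (length (T @ U) - length K))" for k
      using Suc.prems(3) by (intro Suc.hyps(1)[OF S' sTU]) (auto simp: L)
    let ?F = "minor (part_char A (S - {q})) L L" and ?G = "minor (part_char A (S - {q})) (T @ U) (T @ U)"
    \<comment> \<open>Index lists \<open>K\<close> containing \<open>q\<close> are accounted for by
      \<open>?F\<close>; those avoiding \<open>q\<close> by \<open>?G\<close>, shifted by one
      degree.\<close>
    have split: "minor (part_char A S) L L = ?F + [:0, 1:] * ?G"
      by (rule minor_part_char_split[OF L d q])
    have c: "coeff (minor (part_char A S) L L) k = coeff ?F k + (case k of 0 \<Rightarrow> 0 | Suc k' \<Rightarrow> coeff ?G k')" for k
      unfolding split by (auto simp: coeff_pCons split: nat.split)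
    have g: "0 \<le> (-1)^(length L + k) * (case k of 0 \<Rightarrow> 0 | Suc k' \<Rightarrow> coeff ?G k')" for k
      using IH2[of "k - 1"] by (cases k) (auto simp: L)
    have "0 \<le> (-1)^(length L + k) * coeff (minor (part_char A S) L L) k"
      unfolding c using IH1[of k] g[of k] by (simp add: distrib_left)
    moreover have "minor A K K \<le> (-1)^length K * coeff (minor (part_char A S) L L) (length L - length K)"
      if K: "sorted_wrt (<) K" "set K \<subseteq> set L" "set L - set K \<subseteq> S" for K
    proof -
      have lK: "length K \<le> length L"
        using K d card_mono[OF _ K(2)] by (metis List.finite_set distinct_card strict_sorted_iff)
      have par: "(-1)^(length L + (length L - length K)) = ((-1)^length K :: real)"
        using lK by (simp add: minus_one_power_iff)
      show ?thesis
      proof (cases "q \<in> set K")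
        case True
        have "minor A K K \<le> (-1)^length K * coeff ?F (length L - length K)"
          using IH1 K True by auto
        also have "\<dots> \<le> (-1)^length K * coeff (minor (part_char A S) L L) (length L - length K)"
          unfolding c distrib_left using g[of "length L - length K"] unfolding par by simp
        finally show ?thesis .
      next
        case False
        have sub: "set K \<subseteq> set (T @ U)" using K False by (auto simp: L)
        have "length K \<le> length (T @ U)"
          using K d sub card_mono[OF _ sub] by (metis List.finite_set L distinct_card strict_sorted_iff sTU)
        then have e: "length L - length K = Suc (length (T @ U) - length K)" by (simp add: L)
        have "minor A K K \<le> (-1)^length K * coeff ?G (length (T @ U) - length K)"
          using IH2 K sub False d by (auto simp: L)
        moreover have "0 \<le> (-1)^length K * coeff ?F (length L - length K)"
          using IH1[of "length L - length K"] unfolding par by simp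
        ultimately show ?thesis unfolding c distrib_left unfolding e by simp
      qed
    qed
    ultimately show ?thesis by blast
  qed
qed

lemma tn_order_0:
  assumes tn: "tn N A" and K: "sorted_wrt (<) K" "set K \<subseteq> {..<N}" "minor A K K \<noteq> 0"
  shows "Polynomial.order 0 (char_poly (fmat N A)) + length K \<le> N"
proof -
  have P0: "0 \<le> minor A K K" if "sorted_wrt (<) K" "set K \<subseteq> set [0..<N]" for K
    using that by (intro tnD[OF tn]) (auto simp: atLeast0LessThan)
  have eq: "char_poly (fmat N A) = minor (part_char A {..<N}) [0..<N] [0..<N]"
    unfolding char_poly_fmat by (intro minor_cong) (auto simp: char_fun_def part_char_def)
  have "minor A K K \<le> (-1)^length K * coeff (char_poly (fmat N A)) (N - length K)"
    using coeff_minor_part_char[OF _ _ P0, of "{..<N}" "[0..<N]" 0] K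
    unfolding eq by (auto simp: atLeast0LessThan)
  moreover have "0 < minor A K K" using K P0[of K] by (auto simp: atLeast0LessThan)
  ultimately have nz: "coeff (char_poly (fmat N A)) (N - length K) \<noteq> 0" by auto
  have lK: "length K \<le> N"
    using K card_mono[OF _ K(2)] by (metis card_lessThan distinct_card finite_lessThan strict_sorted_iff)
  have p0: "char_poly (fmat N A) \<noteq> 0" using nz by auto
  have "monom 1 (Polynomial.order 0 (char_poly (fmat N A))) dvd char_poly (fmat N A)"
    using order_1[of 0 "char_poly (fmat N A)"] by (simp add: monom_altdef)
  then have "\<not> N - length K < Polynomial.order 0 (char_poly (fmat N A))"
    using nz unfolding monom_1_dvd_iff' by blast
  then show ?thesis using lK by simp
qed

section \<open>The kernel of a degenerate Hurwitz matrix\<close>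

lemma minor_move_col:
  assumes "length is = length T + length U + 1"
  shows "minor A is (T @ w # U) = (-1) ^ length T * minor A is (w # T @ U)"
  using minor_move_row[OF assms, of "\<lambda>i j. A j i" w]
    minor_transpose[of "T @ w # U" "is" A] minor_transpose[of "w # T @ U" "is" A] assms by simp

text \<open>Total nonnegativity needs sorted lists, hence borders at the end; expansions prefer
  borders in front. The sign from moving the row cancels that from moving the column.\<close>

lemma minor_snoc:
  assumes "length I = length J"
  shows "minor A (I @ [x]) (J @ [c]) = minor A (x # I) (c # J)"
proof -
  have "minor A (I @ [x]) (J @ [c]) = (-1) ^ length I * ((-1) ^ length J * minor A (x # I) (c # J))"
    using minor_move_row[of "J @ [c]" I "[]" A x] minor_move_col[of "x # I" J "[]" A c] assms by simp
  also have "\<dots> = minor A (x # I) (c # J)"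
    using assms by (simp add: mult.assoc[symmetric] power_add[symmetric] mult_2[symmetric])
  finally show ?thesis .
qed

lemma minor_snoc2:
  assumes "length I = length J"
  shows "minor A (I @ [u, v]) (J @ [c, d]) = minor A (u # v # I) (c # d # J)"
proof -
  have "minor A (I @ [u, v]) (J @ [c, d])
      = (-1) ^ length I * ((-1) ^ length J * minor A (u # I @ [v]) (c # J @ [d]))"
    using minor_move_row[of "J @ [c, d]" I "[v]" A u] minor_move_col[of "u # I @ [v]" J "[d]" A c] assms by simp
  also have "minor A (u # I @ [v]) (c # J @ [d])
      = (-1) ^ (length I + 1) * ((-1) ^ (length J + 1) * minor A (v # u # I) (d # c # J))"
    using minor_move_row[of "c # J @ [d]" "u # I" "[]" A v] minor_move_col[of "v # u # I" "c # J" "[]" A d] assms by simp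
  also have "minor A (v # u # I) (d # c # J) = minor A (u # v # I) (c # d # J)"
    using minor_move_row[of "d # c # J" "[v]" I A u] minor_move_col[of "u # v # I" "[d]" J A c] assms by simp
  finally show ?thesis
    using assms by (simp add: mult.assoc[symmetric] power_add[symmetric] mult_2[symmetric])
qed

lemma nonzero_minor_kernel:
  fixes A :: "nat \<Rightarrow> nat \<Rightarrow> real"
  assumes nz: "minor A I J \<noteq> 0" and len: "length I = length J" and d: "distinct J"
    and ker: "\<And>x. x \<in> set I \<Longrightarrow> (\<Sum>q\<in>set J. y q * A x q) = 0"
    and q: "q \<in> set J"
  shows "y q = 0"
proof -
  let ?M = "mat (length I) (length I) (\<lambda>(a, b). A (I ! a) (J ! b))"
  let ?v = "vec (length I) (\<lambda>b. y (J ! b))"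
  have "?M *\<^sub>v ?v = 0\<^sub>v (length I)"
  proof (rule eq_vecI)
    fix a assume a: "a < dim_vec (0\<^sub>v (length I) :: real vec)"
    have "(?M *\<^sub>v ?v) $ a = (\<Sum>b<length J. y (J ! b) * A (I ! a) (J ! b))"
      using a len by (auto simp: scalar_prod_def atLeast0LessThan mult.commute intro!: sum.cong)
    also have "\<dots> = (\<Sum>q\<in>set J. y q * A (I ! a) q)"
      using sum.reindex_bij_betw[OF bij_betw_nth[OF d refl refl], of "\<lambda>q. y q * A (I ! a) q"] by simp
    also have "\<dots> = 0" using ker a by simp
    finally show "(?M *\<^sub>v ?v) $ a = 0\<^sub>v (length I) $ a" using a by simp
  qed simp
  moreover have "det ?M \<noteq> 0" using nz unfolding minor_def .
  ultimately have "?v = 0\<^sub>v (length I)"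
    using det_0_iff_vec_prod_zero_field[of ?M "length I"] by (metis mat_carrier vec_carrier)
  moreover obtain b where "b < length J" "q = J ! b" using q by (metis in_set_conv_nth)
  ultimately show ?thesis using len by (metis index_vec index_zero_vec(1))
qed

text \<open>Cramer's rule.\<close>

lemma bordered_minor:
  fixes A :: "nat \<Rightarrow> nat \<Rightarrow> real"
  assumes nz: "minor A I J \<noteq> 0" and len: "length I = length J" and d: "distinct J" "c \<notin> set J"
  shows "\<exists>z. z c = 1 \<and> (\<forall>x. minor A (x # I) (c # J) = minor A I J * (\<Sum>q\<in>insert c (set J). z q * A x q))"
proof -
  define w where "w b = (-1)^b * minor A I (remove_nth b (c # J)) / minor A I J" for b
  \<comment> \<open>Turns weights by position into weights by column; \<open>c # J\<close> is
    distinct, so one summand is left for each column.\<close>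
  define z where "z q = (\<Sum>b<length (c # J). if (c # J) ! b = q then w b else 0)" for q
  have z: "z ((c # J) ! b) = w b" if b: "b < length (c # J)" for b
  proof -
    have "((c # J) ! b' = (c # J) ! b) = (b' = b)" if "b' < length (c # J)" for b'
      using that b d by (intro nth_eq_iff_index_eq) auto
    then have "z ((c # J) ! b) = (\<Sum>b'<length (c # J). if b' = b then w b' else 0)"
      unfolding z_def by (intro sum.cong) auto
    then show ?thesis using b by simp
  qed
  have "minor A (x # I) (c # J) = minor A I J * (\<Sum>q\<in>insert c (set J). z q * A x q)" for x
  proof -
    have "minor A (x # I) (c # J) = (\<Sum>b<length (c # J). (-1)^b * A x ((c # J) ! b) * minor A I (remove_nth b (c # J)))"
      using len by (subst minor_laplace_row[of 0]) (auto simp: remove_nth_def)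
    also have "\<dots> = (\<Sum>b<length (c # J). minor A I J * (z ((c # J) ! b) * A x ((c # J) ! b)))"
      using nz by (intro sum.cong refl) (simp add: z w_def del: nth_Cons_0)
    also have "\<dots> = minor A I J * (\<Sum>q\<in>set (c # J). z q * A x q)"
    proof -
      have "(\<Sum>b<length (c # J). z ((c # J) ! b) * A x ((c # J) ! b)) = (\<Sum>q\<in>set (c # J). z q * A x q)"
        by (rule sum.reindex_bij_betw[OF bij_betw_nth]) (use d in auto)
      then show ?thesis by (simp only: sum_distrib_left[symmetric])
    qed
    finally show ?thesis by simp
  qed
  moreover have "z c = 1" using nz z[of 0] by (simp add: w_def remove_nth_def)
  ultimately show ?thesis by blast
qed

text \<open>A \<open>2 \<times> 2\<close> instance of Sylvester's identity, for a vanishing bordered minor.\<close>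

lemma bordered_minor_2:
  fixes A :: "nat \<Rightarrow> nat \<Rightarrow> real"
  assumes nz: "minor A I J \<noteq> 0" and len: "length I = length J" and d: "distinct J" "c \<notin> set J"
    and u: "minor A (u # I) (c # J) = 0"
  shows "minor A I J * minor A (u # v # I) (c # d # J) = - minor A (v # I) (c # J) * minor A (u # I) (d # J)"
proof -
  obtain z where z: "z c = 1"
    "\<And>x. minor A (x # I) (c # J) = minor A I J * (\<Sum>q\<in>insert c (set J). z q * A x q)"
    using bordered_minor[OF nz len d] by blast
  define S where "S x = (\<Sum>q\<in>insert c (set J). z q * A x q)" for x
  let ?R = "u # v # I" and ?js = "d # J"
  let ?m = "\<lambda>a. minor A (remove_nth a ?R) ?js"
  have exp: "minor A ?R (q # ?js) = (\<Sum>a<length ?R. (-1)^a * A (?R ! a) q * ?m a)" for q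
    using len by (subst minor_laplace_col[of 0]) (auto simp: remove_nth_def)
  have "minor A ?R (q # ?js) = 0" if "q \<in> set J" for q
    using that len by (intro minor_repeat_col) auto
  \<comment> \<open>Replacing column \<open>c\<close> by its combination with weights
    \<open>z\<close> is harmless, as the other columns involved occur already in \<open>J\<close>.
    The new column vanishes in every row except \<open>v\<close>.\<close>
  then have "minor A ?R (c # ?js) = (\<Sum>q\<in>insert c (set J). z q * minor A ?R (q # ?js))"
    using z(1) d by (subst sum.insert) auto
  also have "\<dots> = (\<Sum>a<length ?R. (-1)^a * S (?R ! a) * ?m a)"
    unfolding exp S_def sum_distrib_left sum_distrib_right
    by (subst sum.swap) (auto simp: algebra_simps intro!: sum.cong simp del: sum.insert sum.lessThan_Suc)
  also have "\<dots> = (\<Sum>a\<in>{1}. (-1)^a * S (?R ! a) * ?m a)"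
  proof (rule sum.mono_neutral_right)
    have "S x = 0" if "x \<in> set I \<or> x = u" for x
    proof -
      have "minor A (x # I) (c # J) = 0" using that u minor_repeat[of "x # I"] by auto
      then show ?thesis using z(2)[of x] nz unfolding S_def by simp
    qed
    then show "\<forall>a\<in>{..<length ?R} - {1}. (-1)^a * S (?R ! a) * ?m a = 0"
      by (auto simp: nth_Cons' intro!: nth_mem)
  qed auto
  also have "\<dots> = - (S v * minor A (u # I) (d # J))" by (simp add: remove_nth_def)
  finally show ?thesis unfolding z(2)[of v] S_def by simp
qed

text \<open>\<open>bordered_minor_2\<close> equates a nonnegative product with minus a nonnegative
  product, so both are zero; in the second one the factor through \<open>v\<close> is not.\<close>

lemma tn_singular_border:
  assumes tn: "tn N A" and nz: "minor A I J \<noteq> 0" and len: "length I = length J"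
    and sI: "sorted_wrt (<) (I @ [u, v])" "v < N" and sJ: "sorted_wrt (<) (J @ [c, d])" "d < N"
    and u: "minor A (u # I) (c # J) = 0" and v: "minor A (v # I) (c # J) \<noteq> 0"
  shows "minor A (u # I) (d # J) = 0"
proof -
  have sub: "set (I @ [u, v]) \<subseteq> {..<N}" "set (J @ [c, d]) \<subseteq> {..<N}"
    using sI sJ by (force simp: sorted_wrt_append)+
  have sI': "sorted_wrt (<) I" "sorted_wrt (<) (I @ [u])" "sorted_wrt (<) (I @ [v])"
    and sJ': "sorted_wrt (<) J" "sorted_wrt (<) (J @ [c])" "sorted_wrt (<) (J @ [d])"
    using sI sJ by (auto simp: sorted_wrt_append)
  have d: "distinct J" "c \<notin> set J"
    using sJ' by (auto simp: sorted_wrt_append strict_sorted_iff)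
  have 0: "0 \<le> minor A I J" using tnD[OF tn len sI'(1) sJ'(1)] sub by auto
  have 1: "0 \<le> minor A (v # I) (c # J)" "0 \<le> minor A (u # I) (d # J)"
    using tnD[OF tn _ sI'(3) sJ'(2)] tnD[OF tn _ sI'(2) sJ'(3)] sub len by (auto simp: minor_snoc)
  have "0 \<le> minor A (I @ [u, v]) (J @ [c, d])"
    using sI sJ sub len by (intro tnD[OF tn]) auto
  then have 2: "0 \<le> minor A (u # v # I) (c # d # J)" using len by (simp add: minor_snoc2)
  have "minor A (v # I) (c # J) * minor A (u # I) (d # J) \<le> 0"
    using bordered_minor_2[OF nz len d u, of v d] mult_nonneg_nonneg[OF 0 2] by linarith
  then show ?thesis using 1 v by (auto simp: mult_le_0_iff)
qed

text \<open>Formulated for a coefficient sequence, so that the even case can instantiate it again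
  with \<open>\<lambda>k. a (2 * k)\<close>.\<close>

locale tn_hurwitz =
  fixes a :: "int \<Rightarrow> real" and n :: nat
  assumes a_zero: "k < 0 \<or> k > int n \<Longrightarrow> a k = 0"
    and a0: "0 < a 0" and an: "a (int n) \<noteq> 0"
    and tn_entries: "tn n (\<lambda>i j. a (2 * int j + 1 - int i))"
begin

definition H :: "nat \<Rightarrow> nat \<Rightarrow> real" where
  "H i j = a (2 * int j + 1 - int i)"

lemma tn: "tn n H"
  using tn_entries unfolding H_def .

lemma H_shift: "H (i + 2 * t) (j + t) = H i j"
  by (simp add: H_def algebra_simps)

lemma H_shift_small: "j < t \<Longrightarrow> H (i + 2 * t) j = 0"
  unfolding H_def by (rule a_zero) auto

lemma H_last_col: "i < n \<Longrightarrow> H i (n - 1) = (if i = n - 1 then a (int n) else 0)"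
  unfolding H_def by (auto simp: of_nat_diff intro!: a_zero)

text \<open>The first \<open>t\<close> columns vanish in row \<open>x + 2 * t\<close>, and the
  others repeat row \<open>x\<close>. A column combination that annihilates the lower row therefore
  annihilates the upper one after moving \<open>t\<close> places to the left.\<close>

lemma sum_shift:
  assumes C: "finite C" and sub: "\<And>q. q \<in> C \<Longrightarrow> t \<le> q \<Longrightarrow> q - t \<in> C'" and C': "finite C'"
    and z: "(\<Sum>q\<in>C. z q * H (x + 2 * t) q) = 0"
  shows "(\<Sum>q\<in>C'. (if q + t \<in> C then z (q + t) else 0) * H x q) = 0"
proof -
  have "(\<Sum>q\<in>C. z q * H (x + 2 * t) q) = (\<Sum>q\<in>{q\<in>C. t \<le> q}. z q * H (x + 2 * t) q)"
    by (intro sum.mono_neutral_right) (use C in auto, meson H_shift_small not_le)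
  also have "\<dots> = (\<Sum>q\<in>(\<lambda>q. q + t) ` {q\<in>C'. q + t \<in> C}. z q * H (x + 2 * t) q)"
  proof (rule sum.cong)
    show "{q \<in> C. t \<le> q} = (\<lambda>q. q + t) ` {q \<in> C'. q + t \<in> C}"
    proof (intro equalityI subsetI)
      fix q assume "q \<in> {q \<in> C. t \<le> q}"
      then have "q = (q - t) + t" "q - t \<in> {q \<in> C'. q + t \<in> C}" using sub by auto
      then show "q \<in> (\<lambda>q. q + t) ` {q \<in> C'. q + t \<in> C}" by blast
    qed auto
  qed simp
  also have "\<dots> = (\<Sum>q\<in>{q\<in>C'. q + t \<in> C}. z (q + t) * H x q)"
    by (subst sum.reindex) (auto simp: H_shift inj_on_def)
  also have "\<dots> = (\<Sum>q\<in>C'. (if q + t \<in> C then z (q + t) else 0) * H x q)"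
    using C' by (intro sum.mono_neutral_cong_left) auto
  finally show ?thesis using z by simp
qed

end

locale tn_hurwitz_degenerate = tn_hurwitz +
  fixes m :: nat
  assumes m: "m < n" and nz: "minor H [0..<m] [0..<m] \<noteq> 0"
    and z: "minor H [0..<m + 1] [0..<m + 1] = 0"
begin

text \<open>For \<open>n = m + 1\<close> the last column would make the vanishing minor
  \<open>a_n\<close> times the nonvanishing one.\<close>

lemma m2: "m + 2 \<le> n"
proof (rule ccontr)
  assume "\<not> m + 2 \<le> n"
  then have n: "n = m + 1" using m by simp
  have "minor H [0..<m + 1] [0..<m + 1] = minor H (m # [0..<m]) (m # [0..<m])"
    using minor_snoc[of "[0..<m]" "[0..<m]" H m m] by simp
  also have "\<dots> = H m m * minor H [0..<m] [0..<m]"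
    using H_last_col n by (intro minor_top_pivot) auto
  finally show False using z nz an H_last_col[of m] n by simp
qed

text \<open>With row \<open>m + 1\<close> as auxiliary row, \<open>tn_singular_border\<close>
  carries the vanishing from column \<open>m\<close> to all later columns.\<close>

lemma row_m_zero:
  assumes "c < n"
  shows "minor H (m # [0..<m]) (c # [0..<m]) = 0"
proof -
  have u: "minor H (m # [0..<m]) (m # [0..<m]) = 0"
    using minor_snoc[of "[0..<m]" "[0..<m]" H m m] z by simp
  have v: "minor H ((m + 1) # [0..<m]) (m # [0..<m]) \<noteq> 0"
  proof
    \<comment> \<open>The Cramer vector \<open>y\<close> would annihilate rows \<open>0\<close> to
      \<open>m + 1\<close>. Moved one column to the left it annihilates the first \<open>m\<close>
      rows and has entry 1 at \<open>m - 1\<close>, contradicting the nonzero minor. For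
      \<open>m = 0\<close> the entry \<open>a 0\<close> of row 1 contradicts directly.\<close>
    assume v: "minor H ((m + 1) # [0..<m]) (m # [0..<m]) = 0"
    obtain y where y: "y m = 1"
      "\<And>x. minor H (x # [0..<m]) (m # [0..<m]) = minor H [0..<m] [0..<m] * (\<Sum>q\<in>insert m (set [0..<m]). y q * H x q)"
      using bordered_minor[OF nz, of m] by auto
    have ins: "insert m (set [0..<m]) = {..m}" by auto
    have Y: "(\<Sum>q\<in>{..m}. y q * H x q) = 0" if "x < m + 2" for x
    proof -
      have "minor H (x # [0..<m]) (m # [0..<m]) = 0"
        using that u v minor_repeat[of "x # [0..<m]"] by (cases "x < m") (auto simp: less_Suc_eq)
      then show ?thesis using y(2)[of x, unfolded ins] nz by simp
    qed
    show False
    proof (cases m)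
      case 0
      then show False using Y[of 1] y(1) a0 by (simp add: H_def)
    next
      case (Suc m')
      let ?y = "\<lambda>q. if q + 1 \<in> {..m} then y (q + 1) else 0"
      have "?y m' = 0"
      proof (rule nonzero_minor_kernel[OF nz, where y = ?y])
        fix x assume "x \<in> set [0..<m]"
        then show "(\<Sum>q\<in>set [0..<m]. ?y q * H x q) = 0"
          using Y[of "x + 2 * 1"] by (intro sum_shift[of "{..m}" 1]) auto
      qed (use Suc in auto)
      then show False using y(1) Suc by simp
    qed
  qed
  consider "c < m" | "c = m" | "m < c" by linarith
  then show ?thesis
  proof cases
    case 1
    then show ?thesis by (intro minor_repeat_col) auto
  next
    case 2
    then show ?thesis using u by simp
  next
    case 3
    show ?thesis
      by (rule tn_singular_border[OF tn nz _ _ _ _ _ u v]) (use 3 assms m2 in \<open>auto simp: sorted_wrt_append\<close>)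
  qed
qed

text \<open>In terms of polynomials, the product of \<open>z^m - \<Sum>w\<^sub>i z^i\<close> and \<open>\<Sum>a\<^sub>k z^k\<close> is even.\<close>

lemma row_dependence:
  "\<exists>w. \<forall>t c. H (m + 2 * t) c = (\<Sum>i<m. w i * H (i + 2 * t) c)"
proof -
  have "minor (\<lambda>i j. H j i) [0..<m] [0..<m] \<noteq> 0" using nz minor_transpose[of "[0..<m]" "[0..<m]" H] by simp
  from bordered_minor[OF this, of m] obtain y where y: "y m = 1"
    "\<And>c. minor (\<lambda>i j. H j i) (c # [0..<m]) (m # [0..<m])
      = minor (\<lambda>i j. H j i) [0..<m] [0..<m] * (\<Sum>q\<in>insert m (set [0..<m]). y q * H q c)"
    by auto
  define w where "w i = - y i" for i
  have w: "H m c = (\<Sum>i<m. w i * H i c)" for c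
  proof (cases "c < n")
    case True
    have "minor (\<lambda>i j. H j i) (c # [0..<m]) (m # [0..<m]) = 0"
      using row_m_zero[OF True] minor_transpose[of "c # [0..<m]" "m # [0..<m]" H] by simp
    then have "(\<Sum>q\<in>insert m (set [0..<m]). y q * H q c) = 0"
      using y(2)[of c] \<open>minor (\<lambda>i j. H j i) [0..<m] [0..<m] \<noteq> 0\<close> by simp
    then show ?thesis using y(1) by (simp add: w_def sum_negf atLeast0LessThan)
  next
    case False
    then have "H i c = 0" if "i \<le> m" for i unfolding H_def using that m by (intro a_zero) auto
    then show ?thesis by simp
  qed
  have "H (m + 2 * t) c = (\<Sum>i<m. w i * H (i + 2 * t) c)" for t c
  proof (cases "t \<le> c")
    case True
    then show ?thesis using w[of "c - t"] H_shift[of _ t "c - t"] by simp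
  qed (simp add: H_shift_small)
  then show ?thesis by blast
qed

text \<open>For odd \<open>n + m\<close> some column has \<open>a_n\<close> in row \<open>m\<close>.
  The rows above carry indices beyond \<open>n\<close> there, so row \<open>m\<close> could not
  depend on them.\<close>

lemma parity: "even (n + m)"
proof (rule ccontr)
  assume "odd (n + m)"
  then have c: "2 * int ((n + m - 1) div 2) + 1 = int n + int m" using m by presburger
  obtain w where w: "\<And>t c. H (m + 2 * t) c = (\<Sum>i<m. w i * H (i + 2 * t) c)"
    using row_dependence by blast
  have "H i ((n + m - 1) div 2) = 0" if "i < m" for i
    unfolding H_def c using that by (intro a_zero) auto
  then have "H m ((n + m - 1) div 2) = 0" using w[of 0 "(n + m - 1) div 2"] by simp
  then show False unfolding H_def c using an by simp
qed

section \<open>Independent rows and the kernel\<close>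

definition s :: nat where "s = (n - m) div 2"

lemma s: "n = m + 2 * s"
  using parity m unfolding s_def by (metis add.commute even_diff_nat even_two_times_div_two le_add_diff_inverse less_imp_le)

text \<open>The indices left out, \<open>m\<close>, \<open>m + 2\<close>, ..., are those whose rows
  \<open>row_dependence\<close> expresses by earlier rows.\<close>

definition Ix :: "nat \<Rightarrow> nat list" where
  "Ix j = [0..<m] @ map (\<lambda>k. m + 2 * k + 1) [0..<j]"

lemma Ix_Suc: "Ix (Suc j) = Ix j @ [m + 2 * j + 1]"
  by (simp add: Ix_def)

lemma length_Ix [simp]: "length (Ix j) = m + j"
  by (simp add: Ix_def)

lemma sorted_Ix: "sorted_wrt (<) (Ix j)"
  by (auto simp: Ix_def sorted_wrt_append sorted_wrt_map intro: sorted_wrt_mono_rel[OF _ sorted_wrt_upt])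

lemma set_Ix: "set (Ix j) = {x. x < m + 2 * j \<and> (\<forall>t. x \<noteq> m + 2 * t)}"
proof (intro equalityI subsetI)
  fix x assume "x \<in> {x. x < m + 2 * j \<and> (\<forall>t. x \<noteq> m + 2 * t)}"
  then have x: "x < m + 2 * j" "\<And>t. x \<noteq> m + 2 * t" by auto
  show "x \<in> set (Ix j)"
  proof (cases "x < m")
    case False
    have "odd (x - m)"
    proof
      assume "even (x - m)"
      then obtain k where "x - m = 2 * k" by (elim evenE)
      then show False using x(2)[of k] False by simp
    qed
    then obtain k where "x - m = 2 * k + 1" by (elim oddE)
    then show ?thesis using x(1) False by (auto simp: Ix_def image_iff intro!: bexI[of _ k])
  qed (simp add: Ix_def)
qed (auto simp: Ix_def, presburger)

text \<open>Row \<open>m + 2 * t\<close> is a combination of the rows \<open>i + 2 * t\<close> with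
  \<open>i < m\<close>. These may be dependent rows themselves, hence strong induction.\<close>

lemma kills_all_rows:
  assumes "\<And>x. x < R \<Longrightarrow> (\<forall>t. x \<noteq> m + 2 * t) \<Longrightarrow> (\<Sum>q\<in>C. y q * H x q) = 0"
  shows "x < R \<Longrightarrow> (\<Sum>q\<in>C. y q * H x q) = 0"
proof (induction x rule: less_induct)
  case (less x)
  show ?case
  proof (cases "\<exists>t. x = m + 2 * t")
    case True
    then obtain t where t: "x = m + 2 * t" by blast
    obtain w where w: "\<And>t c. H (m + 2 * t) c = (\<Sum>i<m. w i * H (i + 2 * t) c)"
      using row_dependence by blast
    have "(\<Sum>q\<in>C. y q * H x q) = (\<Sum>q\<in>C. \<Sum>i<m. w i * (y q * H (i + 2 * t) q))"
      unfolding t w by (simp add: sum_distrib_left algebra_simps)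
    also have "\<dots> = (\<Sum>i<m. w i * (\<Sum>q\<in>C. y q * H (i + 2 * t) q))"
      by (subst sum.swap) (simp add: sum_distrib_left)
    also have "\<dots> = 0" using less t by (intro sum.neutral) auto
    finally show ?thesis .
  qed (use assms less in blast)
qed

text \<open>Bordering by row \<open>u\<close> and the far column \<open>d\<close> gives a visibly
  nonzero minor. If bordering by column \<open>u\<close> gave zero,
  \<open>tn_singular_border\<close> with the next independent row \<open>u + 2\<close> would make
  the minor at \<open>d\<close> vanish too.\<close>

lemma minor_Ix_nonzero: "j \<le> s \<Longrightarrow> minor H (Ix j) (Ix j) \<noteq> 0"
proof (induction j)
  case 0
  then show ?case using nz by (simp add: Ix_def)
next
  case (Suc j)
  define u where "u = m + 2 * j + 1"
  \<comment> \<open>The column in which row \<open>u\<close> carries \<open>a_n\<close>, since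
    \<open>2 * d + 1 - u = n\<close>; all rows of \<open>Ix j\<close> lie above \<open>u\<close> and
    are zero there.\<close>
  define d where "d = s + m + j"
  have nzj: "minor H (Ix j) (Ix j) \<noteq> 0" using Suc by simp
  have dIx: "distinct (Ix j)" "u \<notin> set (Ix j)"
    using sorted_Ix strict_sorted_iff by (blast, auto simp: set_Ix u_def)
  have Hd: "H x d = a (int n + int u - int x)" for x
    unfolding H_def using s by (intro arg_cong[of _ _ a]) (simp add: d_def u_def)
  have "minor H (u # Ix j) (d # Ix j) = H u d * minor H (Ix j) (Ix j)"
    by (rule minor_top_pivot) (auto simp: Hd set_Ix u_def intro!: a_zero)
  also have "H u d = a (int n)" by (simp add: Hd)
  finally have nzd: "minor H (u # Ix j) (d # Ix j) \<noteq> 0" using an nzj by simp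
  have "minor H (u # Ix j) (u # Ix j) \<noteq> 0"
  proof
    assume zu: "minor H (u # Ix j) (u # Ix j) = 0"
    then have "u \<noteq> d" using nzd by auto
    then have j2: "j + 2 \<le> s" "u < d" using Suc.prems by (auto simp: u_def d_def)
    define v where "v = u + 2"
    have nzv: "minor H (v # Ix j) (u # Ix j) \<noteq> 0"
    proof
      \<comment> \<open>As for row \<open>m\<close>, a vector annihilating all rows below index
        \<open>m + 2 * j + 4\<close> is shifted. The shift is by two columns, hence four rows: a
        shift by one would move the columns \<open>m + 1\<close>, \<open>m + 3\<close>, ... onto
        omitted ones.\<close>
      assume zv: "minor H (v # Ix j) (u # Ix j) = 0"
      obtain y where y: "y u = 1"
        "\<And>x. minor H (x # Ix j) (u # Ix j) = minor H (Ix j) (Ix j) * (\<Sum>q\<in>insert u (set (Ix j)). y q * H x q)"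
        using bordered_minor[OF nzj refl dIx] by blast
      have "(\<Sum>q\<in>insert u (set (Ix j)). y q * H x q) = 0" if "x \<in> set (Ix j) \<or> x = u \<or> x = v" for x
      proof -
        have "minor H (x # Ix j) (u # Ix j) = 0"
          using that zu zv minor_repeat[of "x # Ix j"] by auto
        then show ?thesis using y(2)[of x] nzj by (metis mult_eq_0_iff)
      qed
      moreover have "x \<in> set (Ix j) \<or> x = u \<or> x = v" if "x < m + 2 * j + 4" "\<forall>t. x \<noteq> m + 2 * t" for x
      proof -
        have "x \<noteq> m + 2 * j" "x \<noteq> m + 2 * (j + 1)" using that(2) by blast+
        then have "x < m + 2 * j \<or> x = u \<or> x = v" using that(1) unfolding u_def v_def by arith
        then show ?thesis using that(2) by (auto simp: set_Ix)
      qed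
      ultimately have Y: "(\<Sum>q\<in>insert u (set (Ix j)). y q * H x q) = 0" if "x < m + 2 * j + 4" for x
        using kills_all_rows[where C = "insert u (set (Ix j))" and y = y, OF _ that] by blast
      show False
      proof (cases "2 \<le> u")
        case True
        let ?C = "insert u (set (Ix j))"
        let ?y = "\<lambda>q. if q + 2 \<in> ?C then y (q + 2) else 0"
        have "?y (u - 2) = 0"
        proof (rule nonzero_minor_kernel[OF nzj refl dIx(1), where y = ?y])
          show "(\<Sum>q\<in>set (Ix j). ?y q * H x q) = 0" if "x \<in> set (Ix j)" for x
          proof (rule sum_shift)
            show "(\<Sum>q\<in>?C. y q * H (x + 2 * 2) q) = 0" using Y[of "x + 2 * 2"] that by (auto simp: set_Ix)
            show "q - 2 \<in> set (Ix j)" if q: "q \<in> ?C" "2 \<le> q" for q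
            proof -
              have "q < m + 2 * j + 2" "\<forall>t. q \<noteq> m + 2 * t"
                using q(1) by (auto simp: set_Ix u_def) presburger+
              moreover have "q - 2 \<noteq> m + 2 * t" for t
                using \<open>\<forall>t. q \<noteq> m + 2 * t\<close>[rule_format, of "t + 1"] q(2) by auto
              ultimately show ?thesis using q(2) by (auto simp: set_Ix)
            qed
          qed auto
          have "u - 2 \<noteq> m + 2 * t" for t using True unfolding u_def by presburger
          then show "u - 2 \<in> set (Ix j)" using True by (auto simp: set_Ix u_def)
        qed
        moreover have "u - 2 + 2 = u" using True by simp
        then have "?y (u - 2) = y u" by (simp only: insertI1 if_True)
        ultimately show False using y(1) by simp
      next
        case False
        then have mj: "m = 0" "j = 0" "u = 1" by (auto simp: u_def)
        have "length (Ix j) = 0" unfolding length_Ix using mj by simp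
        then have "Ix j = []" by (rule length_0_conv[THEN iffD1])
        then have "set (Ix j) = {}" by (simp only: list.set(1))
        then have "y u * H 3 u = 0" using Y[of 3] by simp
        then show False using y(1) a0 mj(3) by (simp add: H_def)
      qed
    qed
    have "minor H (u # Ix j) (d # Ix j) = 0"
    proof (rule tn_singular_border[OF tn nzj refl _ _ _ _ zu nzv])
      show "v < n" "d < n" using j2 s by (auto simp: u_def v_def d_def)
    qed (use sorted_Ix j2 in \<open>auto simp: sorted_wrt_append set_Ix u_def v_def\<close>)
    then show False using nzd by simp
  qed
  then show ?case by (simp add: Ix_Suc minor_snoc u_def)
qed

lemma Ix_bound: "set (Ix s) \<subseteq> {..<n}"
  using s by (auto simp: set_Ix)

lemma order_0_le: "Polynomial.order 0 (char_poly (fmat n H)) \<le> s"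
  using tn_order_0[OF tn sorted_Ix Ix_bound minor_Ix_nonzero[OF order_refl]] s by simp

text \<open>The Cramer vector for bordering \<open>Ix s\<close> by the omitted column
  \<open>m + 2 * t\<close>. It annihilates the rows in \<open>Ix s\<close>, hence all rows; among
  the omitted columns it meets only its own, which makes the vectors for different \<open>t\<close>
  independent.\<close>

lemma kernel_vectors:
  assumes "t < s"
  shows "\<exists>y. y (m + 2 * t) = 1 \<and> (\<forall>t'. t' \<noteq> t \<longrightarrow> y (m + 2 * t') = 0) \<and> (\<forall>x<n. (\<Sum>q<n. H x q * y q) = 0)"
proof -
  let ?c = "m + 2 * t"
  have c: "?c \<notin> set (Ix s)" by (auto simp: set_Ix)
  have d: "distinct (Ix s)" using sorted_Ix strict_sorted_iff by blast
  obtain y where y: "y ?c = 1"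
    "\<And>x. minor H (x # Ix s) (?c # Ix s) = minor H (Ix s) (Ix s) * (\<Sum>q\<in>insert ?c (set (Ix s)). y q * H x q)"
    using bordered_minor[OF minor_Ix_nonzero[OF order_refl] refl d c] by blast
  let ?C = "insert ?c (set (Ix s))"
  have "(\<Sum>q\<in>?C. y q * H x q) = 0" if "x \<in> set (Ix s)" for x
  proof -
    have "minor H (x # Ix s) (?c # Ix s) = 0" using that by (intro minor_repeat) auto
    then show ?thesis using y(2)[of x] minor_Ix_nonzero[of s] by (metis mult_eq_0_iff order_refl)
  qed
  then have Y: "(\<Sum>q\<in>?C. y q * H x q) = 0" if "x < n" for x
    using kills_all_rows[where C = ?C and y = y and R = n, OF _ that] s by (auto simp: set_Ix)
  define y' where "y' q = (if q \<in> ?C then y q else 0)" for q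
  have "(\<Sum>q<n. H x q * y' q) = 0" if "x < n" for x
  proof -
    have "?C \<subseteq> {..<n}" using Ix_bound assms s by auto
    then have "(\<Sum>q<n. H x q * y' q) = (\<Sum>q\<in>?C. y q * H x q)"
      by (intro sum.mono_neutral_cong_right) (auto simp: y'_def)
    then show ?thesis using Y[OF that] by simp
  qed
  moreover have "y' ?c = 1" "\<forall>t'. t' \<noteq> t \<longrightarrow> y' (m + 2 * t') = 0"
    using y(1) by (auto simp: y'_def set_Ix)
  ultimately show ?thesis by blast
qed

end

section \<open>Submatrices, eigenspaces and split polynomials\<close>

lemma pick_set_sorted:
  assumes s: "sorted_wrt (<) xs" and a: "a < length xs"
  shows "pick (set xs) a = xs ! a"
proof -
  have d: "distinct xs" using s strict_sorted_iff by blast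
  have "{x \<in> set xs. x < xs ! a} = (\<lambda>b. xs ! b) ` {..<a}"
  proof (intro equalityI subsetI)
    fix x assume "x \<in> {x \<in> set xs. x < xs ! a}"
    then obtain b where b: "b < length xs" "x = xs ! b" "xs ! b < xs ! a" by (auto simp: in_set_conv_nth)
    have "b < a"
    proof (rule ccontr)
      assume "\<not> b < a"
      then have "a = b \<or> xs ! a < xs ! b"
        using sorted_wrt_nth_less[OF s, of a b] b(1) by (cases "a = b") auto
      then show False using b(3) by auto
    qed
    then show "x \<in> (\<lambda>b. xs ! b) ` {..<a}" using b by blast
  qed (use s a in \<open>auto simp: sorted_wrt_iff_nth_less\<close>)
  moreover have "inj_on (\<lambda>b. xs ! b) {..<a}"
    using d a by (auto simp: inj_on_def nth_eq_iff_index_eq)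
  ultimately have "card {x \<in> set xs. x < xs ! a} = a" by (simp add: card_image)
  then show ?thesis using pick_card_in_set[of "xs ! a" "set xs"] a by simp
qed

lemma det_submatrix_set:
  assumes "sorted_wrt (<) is" "sorted_wrt (<) js" "length is = length js"
    and "set is \<subseteq> {..<dim_row A}" "set js \<subseteq> {..<dim_col A}"
  shows "det (submatrix A (set is) (set js)) = minor (\<lambda>i j. A $$ (i, j)) is js"
proof -
  have c: "card {i. i < dim_row A \<and> i \<in> set is} = length is" "card {j. j < dim_col A \<and> j \<in> set js} = length js"
  proof -
    have "{i. i < dim_row A \<and> i \<in> set is} = set is" "{j. j < dim_col A \<and> j \<in> set js} = set js"
      using assms(4,5) by auto
    then show "card {i. i < dim_row A \<and> i \<in> set is} = length is" "card {j. j < dim_col A \<and> j \<in> set js} = length js"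
      using assms(1,2) distinct_card[of "is"] distinct_card[of js] by (auto simp: strict_sorted_iff)
  qed
  show ?thesis
    unfolding minor_def submatrix_def c assms(3)[symmetric]
    using assms by (intro arg_cong[of _ _ det] eq_matI) (auto simp: pick_set_sorted)
qed

lemma totally_nonneg_imp_tn:
  assumes "totally_nonneg A" "A \<in> carrier_mat N N"
  shows "tn N (\<lambda>i j. A $$ (i, j))"
  unfolding tn_def
proof (intro allI impI)
  fix "is" js :: "nat list"
  assume *: "length is = length js" "sorted_wrt (<) is" "sorted_wrt (<) js" "set is \<subseteq> {..<N}" "set js \<subseteq> {..<N}"
  then have "card (set is) = card (set js)"
    using distinct_card strict_sorted_iff by metis
  then have "0 \<le> det (submatrix A (set is) (set js))"
    using assms * unfolding totally_nonneg_def by auto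
  then show "0 \<le> minor (\<lambda>i j. A $$ (i, j)) is js"
    using * assms(2) by (simp add: det_submatrix_set)
qed

lemma kernel_dim_le_1:
  fixes C :: "real mat"
  assumes C: "C \<in> carrier_mat n n"
    and dep: "\<And>v w. v \<in> mat_kernel C \<Longrightarrow> w \<in> mat_kernel C \<Longrightarrow>
      \<exists>\<alpha> \<beta>. (\<alpha> \<noteq> 0 \<or> \<beta> \<noteq> 0) \<and> (\<forall>i<n. \<alpha> * v $ i + \<beta> * w $ i = 0)"
  shows "kernel_dim C \<le> 1"
proof (rule ccontr)
  assume not: "\<not> kernel_dim C \<le> 1"
  interpret K: kernel n n C by unfold_locales (rule C)
  obtain B where B: "finite B" "K.basis B" using kernel_basis_exists[OF C] by blast
  have "K.dim = card B" using K.Ker.dim_basis[OF B] .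
  then have "2 \<le> card B" using not by simp
  then obtain v w where vw: "v \<in> B" "w \<in> B" "v \<noteq> w"
    by (metis B(1) One_nat_def card_le_Suc0_iff_eq not_less_eq_eq numeral_2_eq_2)
  have BK: "B \<subseteq> mat_kernel C" and li: "\<not> K.lin_dep B"
    using B(2) unfolding K.Ker.basis_def by auto
  obtain \<alpha> \<beta> where ab: "\<alpha> \<noteq> 0 \<or> \<beta> \<noteq> 0" "\<And>i. i < n \<Longrightarrow> \<alpha> * v $ i + \<beta> * w $ i = 0"
    using dep[of v w] vw BK by blast
  define f where "f x = (if x = v then \<alpha> else \<beta>)" for x
  have VW: "{v, w} \<subseteq> mat_kernel C" using vw BK by auto
  have car: "{v, w} \<subseteq> carrier_vec n" using VW mat_kernel_carrier[OF C] by auto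
  have "K.NC.lincomb f {v, w} = 0\<^sub>v n"
  proof (rule eq_vecI)
    fix i assume "i < dim_vec (0\<^sub>v n :: real vec)"
    then have i: "i < n" by simp
    have "K.NC.lincomb f {v, w} $ i = (\<Sum>x\<in>{v, w}. f x * x $ i)"
      by (rule K.NC.lincomb_index[OF i car])
    also have "\<dots> = \<alpha> * v $ i + \<beta> * w $ i" using vw(3) by (simp add: f_def)
    finally show "K.NC.lincomb f {v, w} $ i = 0\<^sub>v n $ i" using ab(2)[OF i] i by simp
  next
    have "K.NC.lincomb f {v, w} \<in> carrier_vec n" using car by (intro K.NC.lincomb_closed) auto
    then show "dim_vec (K.NC.lincomb f {v, w}) = dim_vec (0\<^sub>v n :: real vec)" by simp
  qed
  moreover have "f v \<noteq> 0 \<or> f w \<noteq> 0" using ab(1) vw(3) by (auto simp: f_def)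
  ultimately have "K.NC.lin_dep B"
    unfolding K.NC.lin_dep_def using vw
    by (intro exI[of _ "{v, w}"] exI[of _ f] exI[of _ "if f v \<noteq> 0 then v else w"]) (auto simp: class_ring_simps)
  then show False using li K.lindep_same[OF BK] by simp
qed

lemma kernel_dim_ge:
  fixes C :: "real mat"
  assumes C: "C \<in> carrier_mat n n"
    and v: "\<And>t. t < s \<Longrightarrow> v t \<in> mat_kernel C"
    and e: "\<And>t. t < s \<Longrightarrow> e t < n"
    and delta: "\<And>t t'. t < s \<Longrightarrow> t' < s \<Longrightarrow> v t $ e t' = (if t = t' then 1 else 0)"
  shows "s \<le> kernel_dim C"
proof -
  interpret K: kernel n n C by unfold_locales (rule C)
  obtain B where B: "finite B" "K.basis B" using kernel_basis_exists[OF C] by blast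
  have fd: "K.Ker.fin_dim"
    unfolding K.Ker.fin_dim_def using B unfolding K.Ker.basis_def by auto
  have inj: "inj_on v {..<s}"
    using delta by (auto simp: inj_on_def) (metis zero_neq_one)
  have vK: "v ` {..<s} \<subseteq> mat_kernel C" using v by auto
  have car: "v ` {..<s} \<subseteq> carrier_vec n" using vK mat_kernel_carrier[OF C] by auto
  have "\<not> K.NC.lin_dep (v ` {..<s})"
  proof
    assume "K.NC.lin_dep (v ` {..<s})"
    then obtain f x where lc: "K.NC.lincomb f (v ` {..<s}) = 0\<^sub>v n" and x: "x \<in> v ` {..<s}" "f x \<noteq> 0"
      using K.NC.finite_lin_dep[of "v ` {..<s}"] car by auto
    have "f (v t) = 0" if t: "t < s" for t
    proof -
      have "0 = K.NC.lincomb f (v ` {..<s}) $ e t" unfolding lc using e[OF t] by simp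
      also have "\<dots> = (\<Sum>x\<in>v ` {..<s}. f x * x $ e t)"
        by (rule K.NC.lincomb_index[OF e[OF t] car])
      also have "\<dots> = (\<Sum>t'<s. f (v t') * v t' $ e t)"
        using inj by (simp add: sum.reindex)
      also have "\<dots> = (\<Sum>t'<s. if t' = t then f (v t) else 0)"
        using delta t by (intro sum.cong) auto
      finally show ?thesis using t by simp
    qed
    then show False using x by auto
  qed
  then have "\<not> K.lin_dep (v ` {..<s})" using K.lindep_same[OF vK] by simp
  then have "card (v ` {..<s}) \<le> K.dim"
    using K.Ker.li_le_dim(2)[OF fd] vK by auto
  then show ?thesis using inj by (simp add: card_image)
qed

text \<open>In a Jordan form the left side counts the blocks of \<open>x\<close> and the right side
  adds up their sizes; the splitting hypothesis provides the form over the reals.\<close>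

lemma eigenspace_dim_le_order:
  fixes A :: "real mat"
  assumes A: "A \<in> carrier_mat n n" and split: "char_poly A = (\<Prod>a\<leftarrow>as. [:- a, 1:])"
  shows "eigenspace_dim A x \<le> alg_mult A x"
proof -
  obtain n_as where j: "jordan_nf A n_as" using jordan_nf_exists[OF A split] by blast
  have "eigenspace_dim A x = dim_gen_eigenspace A x 1"
    using A unfolding eigenspace_dim_def dim_gen_eigenspace_def by simp
  also have "\<dots> = (\<Sum>n\<leftarrow>map fst [(n, e)\<leftarrow>n_as . e = x]. min 1 n)"
    by (rule dim_gen_eigenspace[OF j])
  also have "\<dots> \<le> (\<Sum>n\<leftarrow>map fst [(n, e)\<leftarrow>n_as . e = x]. n)"
    by (rule sum_list_mono) simp
  also have "\<dots> = alg_mult A x"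
    unfolding alg_mult_def jordan_nf_order[OF j] by (simp add: case_prod_beta')
  finally show ?thesis .
qed

lemma real_rooted_poly_splits:
  fixes p :: "real poly"
  assumes monic: "lead_coeff p = 1"
    and real: "\<And>z. poly (map_poly complex_of_real p) z = 0 \<Longrightarrow> Im z = 0"
  shows "\<exists>as. p = (\<Prod>a\<leftarrow>as. [:- a, 1:]) \<and> length as = degree p"
proof -
  let ?P = "map_poly complex_of_real p"
  obtain zs where zs: "Polynomial.smult (coeff ?P (degree ?P)) (\<Prod>a\<leftarrow>zs. [:- a, 1:]) = ?P" "length zs = degree ?P"
    using fundamental_theorem_algebra_factorized by blast
  have deg: "degree ?P = degree p" by simp
  have P: "?P = (\<Prod>a\<leftarrow>zs. [:- a, 1:])" using zs(1) monic by (simp add: deg)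
  have "Im z = 0" if "z \<in> set zs" for z
    using that by (intro real) (auto simp: P poly_prod_list prod_list_zero_iff)
  then have zs': "zs = map complex_of_real (map Re zs)"
    by (auto simp: complex_eq_iff intro!: map_idI[symmetric])
  have "?P = map_poly complex_of_real (\<Prod>a\<leftarrow>map Re zs. [:- a, 1:])"
    unfolding P by (subst zs') (simp add: cr.hom_prod_list o_def map_poly_pCons)
  then have "p = (\<Prod>a\<leftarrow>map Re zs. [:- a, 1:])" by simp
  then show ?thesis using zs(2) deg by (metis length_map)
qed

lemma order_prod_linear: "Polynomial.order x (\<Prod>a\<leftarrow>as. [:- a, 1:]) = count_list as (x :: real)"
proof (induction as)
  case (Cons a as)
  have "(\<Prod>a\<leftarrow>as. [:- a, 1:]) \<noteq> (0 :: real poly)" by (auto simp: prod_list_zero_iff)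
  then have "Polynomial.order x (\<Prod>a\<leftarrow>(a # as). [:- a, 1:])
      = Polynomial.order x [:- a, 1:] + count_list as x"
    using Cons by (simp only: list.map prod_list.Cons) (subst order_mult, simp_all only: mult_eq_0_iff, simp_all)
  also have "Polynomial.order x [:- a, 1:] = (if x = a then 1 else 0)"
    using order_linear_power[of x "- a" 1] by simp
  finally show ?case by simp
qed simp

section \<open>The spectrum of a totally nonnegative Hurwitz matrix\<close>

context tn_hurwitz
begin

lemma minor_ineq:
  assumes "i < k" "k < n" "j < l" "l < n"
  shows "H i l * H k j \<le> H i j * H k l"
  using tn_2[OF tn assms] .

lemma a_nonneg: "0 \<le> a (int k)"
proof (cases "k \<le> n \<and> 2 \<le> n")
  case True
  show ?thesis
  proof (cases "even k")
    case True
    then obtain l where l: "k = 2 * l" by (elim evenE)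
    have "0 \<le> H 1 l" using \<open>k \<le> n \<and> 2 \<le> n\<close> l by (intro tn_entry[OF tn]) auto
    then show ?thesis by (simp add: H_def l)
  next
    case False
    then obtain l where l: "k = 2 * l + 1" by (elim oddE)
    have "0 \<le> H 0 l" using \<open>k \<le> n \<and> 2 \<le> n\<close> l by (intro tn_entry[OF tn]) auto
    then show ?thesis by (simp add: H_def l add.commute)
  qed
next
  case False
  have "0 \<le> H 0 0" if "n = 1" using that by (intro tn_entry[OF tn]) auto
  then have "0 \<le> a 1" if "n = 1" using that by (simp add: H_def)
  moreover have "k = 0 \<or> k = 1 \<and> n = 1 \<or> n < k" using False by linarith
  ultimately show ?thesis using a0 a_zero[of "int k"] by auto
qed

lemma an_pos: "0 < a (int n)"
  using a_nonneg[of n] an by simp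

text \<open>Vanishing of one coefficient propagates along its parity class and then contradicts
  \<open>a\<^sub>n \<noteq> 0\<close>.\<close>

lemma coeff_pos:
  assumes a1: "0 < a 1" and "k \<le> n"
  shows "0 < a (int k)"
  using assms(2)
proof (induction k rule: less_induct)
  case (less k)
  have odd_le: "a (2 * int l + 1) * a (2 * int j) \<le> a (2 * int j + 1) * a (2 * int l)" if "j < l" "l < n" "2 \<le> n" for j l
    using minor_ineq[of 0 1 j l] that by (simp add: H_def)
  have even_le: "a (2 * int l) * a (2 * int j - 1) \<le> a (2 * int j) * a (2 * int l - 1)" if "j < l" "l < n" "3 \<le> n" for j l
    using minor_ineq[of 1 2 j l] that by (simp add: H_def)
  show ?case
  proof (rule ccontr)
    assume "\<not> 0 < a (int k)"
    then have zk: "a (int k) = 0" using a_nonneg[of k] by simp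
    have "k \<noteq> 0" using zk a0 by (intro notI) simp
    moreover have "k \<noteq> 1" using zk a1 by (intro notI) simp
    moreover have "k \<noteq> n" using zk an by (intro notI) simp
    ultimately have k: "2 \<le> k" "k < n" using less.prems by auto
    then have n3: "3 \<le> n" by simp
    have pos: "0 < a (int i)" if "i < k" for i using less that by auto
    show False
    proof (cases "even k")
      case True
      then obtain j where j: "k = 2 * j" by (elim evenE)
      have ev0: "a (2 * int l) = 0" if "j \<le> l" "l < n" for l
      proof (cases "l = j")
        case False
        have "a (2 * int l) * a (2 * int j - 1) \<le> 0"
          using even_le[of j l] that False n3 zk j by simp
        moreover have "0 < a (2 * int j - 1)" using pos[of "k - 1"] j k by (simp add: of_nat_diff)
        ultimately show ?thesis using a_nonneg[of "2 * l"] by (auto simp: mult_le_0_iff)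
      qed (use zk j in simp)
      \<comment> \<open>If \<open>n\<close> has the parity of \<open>k\<close>, \<open>a_n\<close>
        lies in the vanishing class. Otherwise, here and in the odd case, one more minor bounds
        \<open>a_n\<close> times a positive coefficient by a product with a factor from that
        class.\<close>
      show False
      proof (cases "even n")
        case True
        then obtain l where "n = 2 * l" by (elim evenE)
        then show False using ev0[of l] an k j by simp
      next
        case False
        then obtain l where l: "n = 2 * l + 1" by (elim oddE)
        have "a (2 * int l + 1) * a (2 * int 0) \<le> a (2 * int 0 + 1) * a (2 * int l)"
          using l k by (intro odd_le) auto
        also have "\<dots> = 0" using ev0[of l] l k j by simp
        finally have "a (int n) * a 0 \<le> 0" by (simp add: l algebra_simps)
        then show False using an_pos a0 by (simp add: mult_le_0_iff)
      qed
    next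
      case False
      then obtain j where j: "k = 2 * j + 1" by (elim oddE)
      have od0: "a (2 * int l + 1) = 0" if "j \<le> l" "l < n" for l
      proof (cases "l = j")
        case False
        have "a (2 * int l + 1) * a (2 * int j) \<le> 0"
          using odd_le[of j l] that False n3 zk j by (simp add: algebra_simps)
        moreover have "0 < a (2 * int j)" using pos[of "2 * j"] j k by simp
        ultimately show ?thesis using a_nonneg[of "2 * l + 1"] by (auto simp: mult_le_0_iff algebra_simps)
      qed (use zk j in \<open>simp add: algebra_simps\<close>)
      show False
      proof (cases "even n")
        case True
        then obtain l where l: "n = 2 * l" by (elim evenE)
        have "a (2 * int l) * a (2 * int j - 1) \<le> a (2 * int j) * a (2 * int l - 1)"
          using l k j by (intro even_le) auto
        also have "a (2 * int l - 1) = 0" using od0[of "l - 1"] l k j by (simp add: of_nat_diff algebra_simps)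
        finally have "a (int n) * a (2 * int j - 1) \<le> 0" by (simp add: l)
        moreover have "0 < a (2 * int j - 1)" using pos[of "2 * j - 1"] j k by (simp add: of_nat_diff)
        ultimately show False using an_pos by (simp add: mult_le_0_iff)
      next
        case False
        then obtain l where "n = 2 * l + 1" by (elim oddE)
        then show False using od0[of l] an k j by (simp add: algebra_simps)
      qed
    qed
  qed
qed

lemma irreducible_tn_H:
  assumes "0 < a 1" "1 \<le> n"
  shows "irreducible_tn True (a (int n)) False n H"
  unfolding irreducible_tn_def
proof (intro conjI impI allI)
  note pos = coeff_pos[OF assms(1)]
  show "0 < H (i + 1) i" if "i + 1 < n" for i
    using pos[of i] that by (simp add: H_def)
  show "0 < H i (i + 1)" if "i + 1 < n" "\<not> (True \<and> i + 2 = n)" for i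
    using pos[of "i + 3"] that by (simp add: H_def add.commute)
  show "H (n - 1) (n - 1) = a (int n)" using H_last_col[of "n - 1"] assms(2) by simp
  show "H i (n - 1) = 0" if "i + 1 < n" for i using H_last_col[of i] that by simp
qed (use tn an_pos assms in auto)

text \<open>Rows 0, 1 and columns 0, \<open>l\<close> annihilate the odd coefficients. For
  \<open>n > 2\<close>, rows 1, 3 and columns 1, \<open>S\<close> bound the positive product of
  \<open>a_n\<close> and \<open>a 0\<close> by a multiple of \<open>a 2\<close>. As
  \<open>a 2\<close> is the second coefficient of \<open>g\<close>, one halving suffices.\<close>

lemma even_case:
  assumes a1: "a 1 = 0" and n: "1 \<le> n"
  shows "\<exists>S. n = 2 * S \<and> (\<forall>k. a (2 * int k + 1) = 0) \<and> 0 < a 2"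
proof -
  have n2: "2 \<le> n" using a1 an n by (cases "n = 1") auto
  have odd0: "a (2 * int l + 1) = 0" for l
  proof (cases "0 < l \<and> l < n")
    case True
    then have "a (2 * int l + 1) * a 0 \<le> 0" using minor_ineq[of 0 1 0 l] n2 a1 by (simp add: H_def)
    then show ?thesis using a0 a_nonneg[of "2 * l + 1"] by (auto simp: mult_le_0_iff algebra_simps)
  next
    case False
    then show ?thesis using a1 a_zero[of "2 * int l + 1"] n by (cases "l = 0") auto
  qed
  have "even n"
  proof (rule ccontr)
    assume "odd n"
    then obtain l where "n = 2 * l + 1" by (elim oddE)
    then show False using odd0[of l] an by (simp add: algebra_simps)
  qed
  then obtain S where S: "n = 2 * S" by (elim evenE)
  have "0 < a 2"
  proof (cases "S = 1")
    case False
    then have "a (int n) * a 0 \<le> a 2 * a (int n - 2)"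
      using minor_ineq[of 1 3 1 S] S n by (simp add: H_def)
    moreover have "0 < a (int n) * a 0" using an_pos a0 by simp
    ultimately have "a 2 \<noteq> 0" by auto
    then show ?thesis using a_nonneg[of 2] by simp
  qed (use an_pos S in simp)
  then show ?thesis using S odd0 by blast
qed

text \<open>After \<open>k\<close> deletions the surviving indices are
  \<open>1, 3, ..., 2 * k - 1\<close> followed by all from \<open>2 * k\<close> on; position
  \<open>k\<close> then holds the zero row of index \<open>2 * k\<close>.\<close>

lemma reduces_to_even:
  assumes n: "n = 2 * S" and odd0: "\<And>k. a (2 * int k + 1) = 0" and k: "k \<le> S"
  shows "reduces_to n H (n - k) (\<lambda>i j. H (if i < k then 2 * i + 1 else i + k) (if j < k then 2 * j + 1 else j + k))"
  using k
proof (induction k)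
  case 0
  then show ?case by (simp add: reduces_to_refl)
next
  case (Suc k)
  let ?f = "\<lambda>k i. if i < k then 2 * i + 1 else i + (k :: nat)"
  have f: "?f k (insert_index k i) = ?f (Suc k) i" for i
    by (auto simp: insert_index_def)
  have z: "H (?f k k) c = 0" for c
  proof -
    have "H (?f k k) c = a (2 * (int c - int k) + 1)" by (simp add: H_def algebra_simps)
    also have "\<dots> = 0"
      using odd0[of "c - k"] a_zero[of "2 * (int c - int k) + 1"] by (cases "k \<le> c") (auto simp: of_nat_diff)
    finally show ?thesis .
  qed
  have "reduces_to (n - k) (\<lambda>i j. H (?f k i) (?f k j)) (n - k - 1)
      (\<lambda>i j. H (?f k (insert_index k i)) (?f k (insert_index k j)))"
    by (rule reduces_to_zero_row) (use Suc n z in auto)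
  then have "reduces_to (n - k) (\<lambda>i j. H (?f k i) (?f k j)) (n - Suc k) (\<lambda>i j. H (?f (Suc k) i) (?f (Suc k) j))"
    unfolding f by simp
  then show ?case using Suc reduces_to_trans by auto
qed

lemma spectrum:
  assumes n: "1 \<le> n"
  shows "thin_eigenspaces n H \<and> (\<exists>d q. char_poly (fmat n H) = [:0, 1:] ^ d * [:- a (int n), 1:] * q
     \<and> (\<forall>z. poly (map_poly complex_of_real q) z = 0 \<longrightarrow> Im z = 0)
     \<and> (\<forall>x. Polynomial.order x q \<le> 1) \<and> (\<forall>x<0. poly q x \<noteq> 0))"
proof (cases "a 1 = 0")
  case False
  then have "0 < a 1" using a_nonneg[of 1] by simp
  then show ?thesis using irreducible_tn_spectrum[OF irreducible_tn_H] n by blast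
next
  case True
  then obtain S where S: "n = 2 * S" "\<And>k. a (2 * int k + 1) = 0" "0 < a 2"
    using even_case n by blast
  define f where "f i = 2 * i + 1" for i :: nat
  have "reduces_to n H S (\<lambda>i j. H (if i < S then 2 * i + 1 else i + S) (if j < S then 2 * j + 1 else j + S))"
    using reduces_to_even[OF S(1,2) order_refl] S(1) by simp
  moreover have "fmat S (\<lambda>i j. H (if i < S then 2 * i + 1 else i + S) (if j < S then 2 * j + 1 else j + S))
      = fmat S (\<lambda>i j. H (f i) (f j))"
    unfolding fmat_def f_def by (rule eq_matI) auto
  moreover have "thin_eigenspaces S (\<lambda>i j. H (f i) (f j)) \<longrightarrow>
      thin_eigenspaces S (\<lambda>i j. H (if i < S then 2 * i + 1 else i + S) (if j < S then 2 * j + 1 else j + S))"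
    unfolding thin_eigenspaces_def eigen_fun_def f_def by simp
  ultimately have reduces_to: "reduces_to n H S (\<lambda>i j. H (f i) (f j))"
    unfolding reduces_to_def by auto
  have Hf: "H (f i) (f j) = a (2 * (2 * int j + 1 - int i))" for i j
    unfolding H_def f_def by (intro arg_cong[of _ _ a]) simp
  interpret g: tn_hurwitz "\<lambda>k. a (2 * k)" S
  proof
    show "a (2 * k) = 0" if "k < 0 \<or> k > int S" for k
      using that S by (intro a_zero) auto
    have "tn S (\<lambda>i j. H (f i) (f j))"
      by (rule tn_compose[OF tn]) (auto simp: f_def S strict_mono_on_def)
    then show "tn S (\<lambda>i j. a (2 * (2 * int j + 1 - int i)))" by (simp add: Hf)
  qed (use a0 an S in auto)
  have gH: "g.H = (\<lambda>i j. H (f i) (f j))"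
    by (intro ext) (simp add: g.H_def Hf)
  have "irreducible_tn True (a (2 * int S)) False S g.H" using g.irreducible_tn_H S n by auto
  from irreducible_tn_spectrum[OF this] obtain d q where dq: "char_poly (fmat S g.H) = [:0, 1:] ^ d * [:- a (2 * int S), 1:] * q"
    and q: "\<forall>z. poly (map_poly complex_of_real q) z = 0 \<longrightarrow> Im z = 0"
      "\<forall>x. Polynomial.order x q \<le> 1" "\<forall>x<0. poly q x \<noteq> 0" and geo: "thin_eigenspaces S g.H"
    by blast
  obtain d' where "char_poly (fmat n H) = [:0, 1:] ^ d' * char_poly (fmat S g.H)"
    using reduces_to unfolding reduces_to_def gH by blast
  then have "char_poly (fmat n H) = [:0, 1:] ^ (d' + d) * [:- a (int n), 1:] * q"
    unfolding dq by (simp only: power_add mult.assoc S(1) of_nat_mult of_nat_numeral)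
  moreover have "thin_eigenspaces n H" using reduces_to geo unfolding reduces_to_def gH by blast
  ultimately show ?thesis using q by blast
qed

end

section \<open>Application to the Hurwitz matrix of a polynomial\<close>

lemma hurwitz_matrix_fmat:
  "hurwitz_matrix p = fmat (degree p) (\<lambda>i j. desc_coeff p (2 * int j + 1 - int i))"
  unfolding hurwitz_matrix_def fmat_def by (intro eq_matI) (auto simp: algebra_simps)

lemma hurwitz_minor_eq:
  fixes p :: "real poly"
  assumes "j \<le> degree p"
  shows "hurwitz_minor p j = minor (\<lambda>i j. desc_coeff p (2 * int j + 1 - int i)) [0..<j] [0..<j]"
proof -
  have "hurwitz_minor p j = det (submatrix (hurwitz_matrix p) (set [0..<j]) (set [0..<j]))"
    using assms by (simp add: hurwitz_minor_def atLeast0LessThan)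
  also have "\<dots> = minor (\<lambda>i j. hurwitz_matrix p $$ (i, j)) [0..<j] [0..<j]"
    by (rule det_submatrix_set) (use assms in \<open>auto simp: hurwitz_matrix_def\<close>)
  also have "\<dots> = minor (\<lambda>i j. desc_coeff p (2 * int j + 1 - int i)) [0..<j] [0..<j]"
    by (rule minor_cong) (use assms in \<open>auto simp: hurwitz_matrix_fmat fmat_def\<close>)
  finally show ?thesis .
qed

theorem theorem6p1:
  fixes p :: "real poly" and n m :: nat
  assumes "degree p = n" and "n \<ge> 1"
    and "desc_coeff p 0 > 0" and "desc_coeff p (int n) \<noteq> 0"
    and "totally_nonneg (hurwitz_matrix p)"
    and "m \<le> n" and "hurwitz_minor p m \<noteq> 0" and "hurwitz_minor p (m + 1) = 0"
  shows "real (\<Sum>x\<in>{x. eigenvalue (hurwitz_matrix p) x \<and> x > 0}. alg_mult (hurwitz_matrix p) x)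
           = (real n + real m) / 2
       \<and> real (alg_mult (hurwitz_matrix p) 0) = (real n - real m) / 2
       \<and> (\<forall>x. eigenvalue (hurwitz_matrix p) x \<and> x > 0 \<longrightarrow> eigenspace_dim (hurwitz_matrix p) x = 1)
       \<and> real (eigenspace_dim (hurwitz_matrix p) 0) = (real n - real m) / 2
       \<and> (\<forall>x. eigenvalue (hurwitz_matrix p) x \<and> x > 0 \<longrightarrow>
            alg_mult (hurwitz_matrix p) x = 1
            \<or> x = poly p 0 \<and> alg_mult (hurwitz_matrix p) x = 2)"
proof -
  let ?a = "desc_coeff p"
  let ?A = "hurwitz_matrix p"
  let ?P = "char_poly ?A"
  have A: "?A \<in> carrier_mat n n" using assms(1) by (simp add: hurwitz_matrix_def)
  interpret tn_hurwitz ?a n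
  proof
    show "?a k = 0" if "k < 0 \<or> k > int n" for k
      using that assms(1) by (auto simp: desc_coeff_def)
    have "tn n (\<lambda>i j. ?A $$ (i, j))" by (rule totally_nonneg_imp_tn[OF assms(5) A])
    moreover have "minor (\<lambda>i j. ?A $$ (i, j)) is js = minor (\<lambda>i j. ?a (2 * int j + 1 - int i)) is js"
      if "set is \<subseteq> {..<n}" "set js \<subseteq> {..<n}" "length is = length js" for "is" js
    proof (rule minor_cong)
      fix x y assume "x < length is" "y < length is"
      then have "is ! x \<in> set is" "js ! y \<in> set js" using that(3) by auto
      then have "is ! x < n" "js ! y < n" using that(1,2) by blast+
      then show "?A $$ (is ! x, js ! y) = ?a (2 * int (js ! y) + 1 - int (is ! x))"
        using assms(1) by (simp add: hurwitz_matrix_fmat fmat_def)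
    qed simp
    ultimately show "tn n (\<lambda>i j. ?a (2 * int j + 1 - int i))" unfolding tn_def by simp
  qed (use assms in auto)
  have HE: "(\<lambda>i j. ?a (2 * int j + 1 - int i)) = H" by (intro ext) (simp add: H_def)
  have AH: "?A = fmat n H" by (simp only: hurwitz_matrix_fmat assms(1) HE)
  have minor_H: "hurwitz_minor p j = minor H [0..<j] [0..<j]" if "j \<le> n" for j
    using hurwitz_minor_eq[of j p, unfolded HE] that assms(1) by simp
  obtain d q where geo: "thin_eigenspaces n H" and P: "?P = [:0, 1:] ^ d * [:- ?a (int n), 1:] * q"
    and q: "\<And>z. poly (map_poly complex_of_real q) z = 0 \<Longrightarrow> Im z = 0"
      "\<And>x. Polynomial.order x q \<le> 1" "\<And>x. x < 0 \<Longrightarrow> poly q x \<noteq> 0"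
    using spectrum assms(2) unfolding AH by blast
  have monic: "lead_coeff ?P = 1" and degP: "degree ?P = n"
    using degree_monic_char_poly[OF A] by auto
  have P0: "?P \<noteq> 0" using monic by auto
  have p0: "poly p 0 = ?a (int n)" using assms(1) by (simp add: desc_coeff_def poly_0_coeff_0)
  have ord: "alg_mult ?A x = (if x = ?a (int n) then 1 else 0) + Polynomial.order x q" if "x \<noteq> 0" for x
  proof -
    have "Polynomial.order x ([:0, 1:] ^ d) = 0"
      using that by (intro order_0I) simp
    moreover have "Polynomial.order x [:- ?a (int n), 1:] = (if x = ?a (int n) then 1 else 0)"
      using order_linear_power[of x "- ?a (int n)" 1] by simp
    ultimately show ?thesis
      unfolding alg_mult_def P using P0 unfolding P by (simp add: order_mult del: mult_pCons_left mult_pCons_right)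
  qed
  \<comment> \<open>All complex zeros of the characteristic polynomial are real, so it splits over
    the reals and multiplicities become counts in a list.\<close>
  obtain as where as: "?P = (\<Prod>a\<leftarrow>as. [:- a, 1:])" "length as = n"
  proof -
    have "Im z = 0" if "poly (map_poly complex_of_real ?P) z = 0" for z
      using that q(1)[of z] unfolding P
      by (auto simp: cr.hom_mult cr.hom_power map_poly_pCons simp del: mult_pCons_left mult_pCons_right)
    then show ?thesis using real_rooted_poly_splits[OF monic] that degP by blast
  qed
  have alg: "alg_mult ?A x = count_list as x" for x
    unfolding alg_mult_def as(1) by (rule order_prod_linear)
  have ev: "eigenvalue ?A x \<longleftrightarrow> x \<in> set as" for x
    unfolding eigenvalue_root_char_poly[OF A] as(1) by (auto simp: poly_prod_list prod_list_zero_iff)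
  have nonneg: "0 \<le> x" if "x \<in> set as" for x
  proof (rule ccontr)
    assume "\<not> 0 \<le> x"
    then have "poly ?P x \<noteq> 0" using q(3)[of x] an_pos unfolding P by (auto simp del: mult_pCons_left mult_pCons_right)
    then show False using that ev[of x] eigenvalue_root_char_poly[OF A] by simp
  qed
  have total: "(\<Sum>x\<in>{x. eigenvalue ?A x \<and> x > 0}. alg_mult ?A x) + alg_mult ?A 0 = n"
  proof -
    have "n = (\<Sum>x\<in>set as. count_list as x)" using as(2) by (simp add: sum_count_set)
    also have "\<dots> = (\<Sum>x\<in>insert 0 {x. eigenvalue ?A x \<and> x > 0}. count_list as x)"
      using nonneg by (intro sum.mono_neutral_left) (auto simp: ev count_list_0_iff intro: order.not_eq_order_implies_strict)
    also have "\<dots> = count_list as 0 + (\<Sum>x\<in>{x. eigenvalue ?A x \<and> x > 0}. count_list as x)"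
      by (rule sum.insert) (auto simp: ev)
    finally show ?thesis unfolding alg by simp
  qed
  have le: "eigenspace_dim ?A x \<le> alg_mult ?A x" for x
    by (rule eigenspace_dim_le_order[OF A as(1)])
  have dim1: "eigenspace_dim ?A x = 1" if x: "eigenvalue ?A x" "x > 0" for x
  proof -
    have C: "char_matrix ?A x \<in> carrier_mat n n" using A by simp
    have ker: "eigen_fun n H x (\<lambda>i. v $ i)" if v: "v \<in> mat_kernel (char_matrix ?A x)" for v
      unfolding eigen_fun_def
    proof (intro allI impI)
      fix i assume i: "i < n"
      have vc: "v \<in> carrier_vec n" "char_matrix ?A x *\<^sub>v v = 0\<^sub>v n" using mat_kernelD[OF C v] by auto
      have "0 = (char_matrix ?A x *\<^sub>v v) $ i" using vc i by simp
      also have "\<dots> = (\<Sum>j<n. (H i j - (if i = j then x else 0)) * v $ j)"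
        using i vc(1) unfolding AH
        by (auto simp: char_matrix_def fmat_def scalar_prod_def atLeast0LessThan intro!: sum.cong)
      also have "\<dots> = (\<Sum>j<n. H i j * v $ j) - x * v $ i"
        using i by (simp add: left_diff_distrib sum_subtractf if_distrib[of "\<lambda>y. y * _"] cong: if_cong)
      finally show "(\<Sum>j<n. H i j * v $ j) = x * v $ i" by simp
    qed
    have "eigenspace_dim ?A x \<le> 1"
      unfolding eigenspace_dim_def
    proof (rule kernel_dim_le_1[OF C])
      fix v w assume v: "v \<in> mat_kernel (char_matrix ?A x)" and w: "w \<in> mat_kernel (char_matrix ?A x)"
      have "x \<noteq> 0" using x(2) by simp
      then show "\<exists>\<alpha> \<beta>. (\<alpha> \<noteq> 0 \<or> \<beta> \<noteq> 0) \<and> (\<forall>i<n. \<alpha> * v $ i + \<beta> * w $ i = 0)"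
        using geo[unfolded thin_eigenspaces_def, rule_format, OF _ ker[OF v] ker[OF w]] by blast
    qed
    moreover have "1 \<le> eigenspace_dim ?A x"
    proof -
      obtain v where v: "v \<in> carrier_vec n" "v \<noteq> 0\<^sub>v n" "char_matrix ?A x *\<^sub>v v = 0\<^sub>v n"
        using x(1) A unfolding eigenvalue_def eigenvector_char_matrix[OF A] by auto
      have "\<exists>i<n. v $ i \<noteq> 0"
      proof (rule ccontr)
        assume "\<not> (\<exists>i<n. v $ i \<noteq> 0)"
        then have "v = 0\<^sub>v n" using v(1) by (intro eq_vecI) auto
        then show False using v(2) by simp
      qed
      then obtain i where i: "i < n" "v $ i \<noteq> 0" by blast
      show ?thesis
        unfolding eigenspace_dim_def
      proof (rule kernel_dim_ge[OF C, of 1 "\<lambda>_. (1 / v $ i) \<cdot>\<^sub>v v" "\<lambda>_. i"])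
        show "(1 / v $ i) \<cdot>\<^sub>v v \<in> mat_kernel (char_matrix ?A x)"
          using v C by (intro mat_kernelI[OF C]) (auto simp: mult_mat_vec[OF C])
      qed (use i v in auto)
    qed
    ultimately show ?thesis by simp
  qed
  \<comment> \<open>For \<open>m = n\<close> the determinant is nonzero. Otherwise \<open>s\<close>
    bounds the geometric multiplicity from below and the algebraic one from above.\<close>
  have zero: "2 * alg_mult ?A 0 + m = n \<and> eigenspace_dim ?A 0 = alg_mult ?A 0"
  proof (cases "m = n")
    case True
    then have "minor H [0..<n] [0..<n] \<noteq> 0" using minor_H assms(7) by simp
    then have "alg_mult ?A 0 = 0"
      using tn_order_0[OF tn, of "[0..<n]"] unfolding alg_mult_def AH by (auto simp: atLeast0LessThan)
    then show ?thesis using True le[of 0] by simp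
  next
    case False
    interpret tn_hurwitz_degenerate ?a n m
      by unfold_locales (use False assms(6-8) minor_H in auto)
    have C: "char_matrix ?A 0 \<in> carrier_mat n n" using A by simp
    obtain y where y: "\<And>t. t < s \<Longrightarrow> y t (m + 2 * t) = 1 \<and> (\<forall>t'. t' \<noteq> t \<longrightarrow> y t (m + 2 * t') = 0)
        \<and> (\<forall>x<n. (\<Sum>q<n. H x q * y t q) = 0)"
      using kernel_vectors by metis
    have "s \<le> eigenspace_dim ?A 0"
      unfolding eigenspace_dim_def
    proof (rule kernel_dim_ge[OF C, of s "\<lambda>t. vec n (y t)" "\<lambda>t. m + 2 * t"])
      fix t assume t: "t < s"
      show "vec n (y t) \<in> mat_kernel (char_matrix ?A 0)"
      proof (rule mat_kernelI[OF C])
        show "char_matrix ?A 0 *\<^sub>v vec n (y t) = 0\<^sub>v n"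
          using y[OF t] unfolding AH
          by (intro eq_vecI) (auto simp: char_matrix_def fmat_def scalar_prod_def atLeast0LessThan)
      qed simp
      show "m + 2 * t < n" using t local.s by simp
      fix t' assume "t' < s"
      then show "vec n (y t) $ (m + 2 * t') = (if t = t' then 1 else 0)"
        using y[OF t] local.s by auto
    qed
    moreover have "alg_mult ?A 0 \<le> s" using order_0_le unfolding alg_mult_def AH .
    ultimately have "alg_mult ?A 0 = s" "eigenspace_dim ?A 0 = s" using le[of 0] by auto
    then show ?thesis using local.s by simp
  qed
  have simple: "alg_mult ?A x = 1 \<or> x = poly p 0 \<and> alg_mult ?A x = 2" if x: "eigenvalue ?A x" "x > 0" for x
  proof -
    \<comment> \<open>The eigenspace supplies the lower bound. By \<open>ord\<close>, multiplicity 2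
      requires that \<open>x\<close> be \<open>a_n\<close>, that is \<open>p(0)\<close>, and at the
      same time a zero of \<open>q\<close>.\<close>
    have "1 \<le> alg_mult ?A x" using le[of x] dim1[OF x] by simp
    then show ?thesis using ord[of x] q(2)[of x] x(2) p0 by (auto split: if_splits)
  qed
  have z: "2 * real (alg_mult ?A 0) + real m = real n"
    using zero by (metis of_nat_add of_nat_mult of_nat_numeral)
  obtain S where S: "(\<Sum>x\<in>{x. eigenvalue ?A x \<and> x > 0}. alg_mult ?A x) = S" by blast
  have "real S + real (alg_mult ?A 0) = real n"
    using total unfolding S by (metis of_nat_add)
  then have "real S = (real n + real m) / 2" using z by (simp add: field_simps)
  moreover have "real (alg_mult ?A 0) = (real n - real m) / 2" using z by (simp add: field_simps)
  ultimately show ?thesis using zero dim1 simple unfolding S by metis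
qed

end
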